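(* Let $\mathcal A$ be an arrow algebra and let $\mathsf N(\mathcal A)$ be the set of nuclei on $\mathcal A$, with the preorder induced by $P_{\mathcal A}(A)$ (i.e. $j\le j'$ iff $j\vdash_A j'$). Then the correspondence between implicative morphisms $f:\mathcal A\to\mathcal A$ and cartesian transformations $\Phi_f^+:P_{\mathcal A}\to P_{\mathcal A}$, $(\Phi_f^+)_I(\phi)=f\circ\phi$, yields an equivalence of preorder categories $$\mathsf{ClTrans}(P_{\mathcal A})\simeq\mathsf N(\mathcal A),$$ so, in particular, $$\mathsf{SubTrip}(P_{\mathcal A})\simeq\mathsf N(\mathcal A)^{\mathrm{op}}.$$
   Context: An arrow algebra $\mathcal A=(A,\preccurlyeq,\to,S)$ consists of a poset $(A,\preccurlyeq)$ with all meets $\bigwedge$; a binary operation $\to$ on $A$ (bracketed to the right), antitone in the first and monotone in the second argument; and a subset $S\subseteq A$ (the separator) which is upward closed, closed under modus ponens ($a\to b\in S$ and $a\in S$ imply $b\in S$), and contains the combinators $\mathbf k=\bigwedge_{a,b}a\to b\to a$, $\mathbf s=\bigwedge_{a,b,c}(a\to b\to c)\to(a\to b)\to a\to c$, and $\mathbf a=\bigwedge_{a,(b_i)_{i\in I},(c_i)_{i\in I}}\big(\bigwedge_{i\in I}a\to b_i\to c_i\big)\to a\to\bigwedge_{i\in I}(b_i\to c_i)$. The arrow tripos $P_{\mathcal A}$ has $P_{\mathcal A}(I)=(A^I,\vdash_I)$ with $\phi\vdash_I\psi$ iff $\bigwedge_{i\in I}\phi(i)\to\psi(i)\in S$, and reindexing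 by precomposition. An implicative morphism $f:\mathcal A\to\mathcal B$ is a function $f:A\to B$ such that: (i) $f(a)\in S_B$ for every $a\in S_A$; (ii) there is $r\in S_B$ with $r\preccurlyeq f(a\to a')\to f(a)\to f(a')$ for all $a,a'\in A$; (iii) for every $X\subseteq A\times A$, if $\bigwedge_{(a,a')\in X}a\to a'\in S_A$ then $\bigwedge_{(a,a')\in X}f(a)\to f(a')\in S_B$. A nucleus on $\mathcal A$ is a function $j:A\to A$ such that: (i) $a\preccurlyeq b$ implies $ja\preccurlyeq jb$; (ii) $\bigwedge_{a\in A}a\to ja\in S$; (iii) $\bigwedge_{a,b\in A}(a\to jb)\to ja\to jb\in S$. A Heyting prealgebra is a preorder whose poset reflection is a Heyting algebra; $\mathsf{HeytPre}$ is the category of these with monotone maps inducing Heyting algebra morphisms on poset reflections. A tripos is a pseudofunctor $P:\mathsf{Set}^{\mathrm{op}}\to\mathsf{HeytPre}$ such that each $P(f)$ has a left and a right adjoint as monotone maps, satisfying the Beck–Chevalley condition, and which has a generic element $\sigma\in P(\Sigma)$ for some set $\Sigma$ (every $\phi\in P(X)$ is isomorphic to $P(g)(\sigma)$ for some $g:X\to\Sigma$). A transformation $\Phi:P\to Q$ is a family of monotone maps $\Phi_X:P(X)\to Q(X)$, pseudonatural in $X$; transformations are ordered pointwise, and $\simeq$ denotes isomorphism for this order. It is cartesian if each $\Phi_X$ preserves finite meets up to isomorphism. A closure transformation on $P$ is a cartesian transformation $\Phi:P\to P$ with $\mathrm{id}_P\le\Phi$ and $\Phi\Phi\simeq\Phi$;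 $\mathsf{ClTrans}(P)$ is the preorder of these. A geometric morphism of triposes $\Phi=(\Phi^+,\Phi_+):Q\to P$ is a cartesian transformation $\Phi^+:P\to Q$ with a right adjoint transformation $\Phi_+:Q\to P$ (componentwise adjunction). It is an inclusion if $\Phi^+\Phi_+\simeq\mathrm{id}_Q$. $\mathsf{SubTrip}(P)$ is the collection of geometric inclusions into $P$, preordered by: $(\Phi:Q\hookrightarrow P)\subseteq(\Psi:R\hookrightarrow P)$ iff there is a geometric morphism $\Theta:Q\to R$ with $\Phi_+\simeq\Psi_+\circ\Theta_+$. *)

theory Defs
  imports "HOL-Algebra.Lattice"
begin

section \<open>Preorders and Heyting prealgebras\<close>

text \<open>
  The library locale \<open>weak_partial_order\<close> is that of preordered sets: its axioms force the
  field \<open>eq\<close> to be, on the carrier, the isomorphism relation of the preorder (x below y and y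
  below x). So \<open>.=\<close> is isomorphism throughout, and the following makes a preorder from its
  carrier and its order relation.
\<close>

definition preorder_of :: "'x set \<Rightarrow> ('x \<Rightarrow> 'x \<Rightarrow> bool) \<Rightarrow> 'x gorder" where
  "preorder_of X r = \<lparr>carrier = X, eq = (\<lambda>x y. r x y \<and> r y x), le = r\<rparr>"

text \<open>The library's \<open>isotone\<close> includes that both sides are preorders, but not that the map
  sends carrier to carrier.\<close>

definition monotone_map :: "'x gorder \<Rightarrow> 'y gorder \<Rightarrow> ('x \<Rightarrow> 'y) \<Rightarrow> bool" where
  "monotone_map P Q f \<longleftrightarrow> f \<in> carrier P \<rightarrow> carrier Q \<and> isotone P Q f"

definition adjoint_maps :: "'x gorder \<Rightarrow> 'y gorder \<Rightarrow> ('x \<Rightarrow> 'y) \<Rightarrow> ('y \<Rightarrow> 'x) \<Rightarrow> bool" where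
  "adjoint_maps P Q l r \<longleftrightarrow> monotone_map P Q l \<and> monotone_map Q P r \<and>
     (\<forall>x\<in>carrier P. \<forall>y\<in>carrier Q. l x \<sqsubseteq>\<^bsub>Q\<^esub> y \<longleftrightarrow> x \<sqsubseteq>\<^bsub>P\<^esub> r y)"

definition preserves_finite_meets :: "'x gorder \<Rightarrow> 'y gorder \<Rightarrow> ('x \<Rightarrow> 'y) \<Rightarrow> bool" where
  "preserves_finite_meets P Q f \<longleftrightarrow>
     (\<forall>F m. finite F \<and> F \<subseteq> carrier P \<and> greatest P m (Lower P F)
        \<longrightarrow> greatest Q (f m) (Lower Q (f ` F)))"

definition preorder_equivalence :: "'x gorder \<Rightarrow> 'y gorder \<Rightarrow> ('x \<Rightarrow> 'y) \<Rightarrow> bool" where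
  "preorder_equivalence P Q F \<longleftrightarrow> monotone_map P Q F \<and>
     (\<exists>G. monotone_map Q P G \<and>
        (\<forall>x\<in>carrier P. G (F x) .=\<^bsub>P\<^esub> x) \<and> (\<forall>y\<in>carrier Q. F (G y) .=\<^bsub>Q\<^esub> y))"

definition preorders_equivalent :: "'x gorder \<Rightarrow> 'y gorder \<Rightarrow> bool" where
  "preorders_equivalent P Q \<longleftrightarrow> (\<exists>F. preorder_equivalence P Q F)"

definition poset_reflection :: "'x gorder \<Rightarrow> 'x set gorder" where
  "poset_reflection P =
     \<lparr>carrier = classes\<^bsub>P\<^esub>, eq = (=), le = (\<lambda>C D. \<exists>x\<in>C. \<exists>y\<in>D. x \<sqsubseteq>\<^bsub>P\<^esub> y)\<rparr>"

text \<open>For monotone \<open>f\<close> all members of the union below coincide.\<close>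

definition reflection_map :: "'y gorder \<Rightarrow> ('x \<Rightarrow> 'y) \<Rightarrow> 'x set \<Rightarrow> 'y set" where
  "reflection_map Q f C = (\<Union>x\<in>C. class_of\<^bsub>Q\<^esub> (f x))"

definition is_relative_pseudocomplement :: "'x gorder \<Rightarrow> 'x \<Rightarrow> 'x \<Rightarrow> 'x \<Rightarrow> bool" where
  "is_relative_pseudocomplement L x y z \<longleftrightarrow>
     greatest L z {w \<in> carrier L. w \<sqinter>\<^bsub>L\<^esub> x \<sqsubseteq>\<^bsub>L\<^esub> y}"

definition heyting_imp :: "'x gorder \<Rightarrow> 'x \<Rightarrow> 'x \<Rightarrow> 'x" where
  "heyting_imp L x y = (THE z. is_relative_pseudocomplement L x y z)"

definition heyting_algebra :: "'x gorder \<Rightarrow> bool" where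
  "heyting_algebra L \<longleftrightarrow> bounded_lattice L \<and>
     (\<forall>x\<in>carrier L. \<forall>y\<in>carrier L. \<exists>z. is_relative_pseudocomplement L x y z)"

definition heyting_hom :: "'x gorder \<Rightarrow> 'y gorder \<Rightarrow> ('x \<Rightarrow> 'y) \<Rightarrow> bool" where
  "heyting_hom L M h \<longleftrightarrow> h \<in> carrier L \<rightarrow> carrier M \<and>
     h \<top>\<^bsub>L\<^esub> = \<top>\<^bsub>M\<^esub> \<and> h \<bottom>\<^bsub>L\<^esub> = \<bottom>\<^bsub>M\<^esub> \<and>
     (\<forall>x\<in>carrier L. \<forall>y\<in>carrier L.
        h (x \<sqinter>\<^bsub>L\<^esub> y) = h x \<sqinter>\<^bsub>M\<^esub> h y \<and>
        h (x \<squnion>\<^bsub>L\<^esub> y) = h x \<squnion>\<^bsub>M\<^esub> h y \<and>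
        h (heyting_imp L x y) = heyting_imp M (h x) (h y))"

definition heyting_prealgebra :: "'x gorder \<Rightarrow> bool" where
  "heyting_prealgebra P \<longleftrightarrow> weak_partial_order P \<and> heyting_algebra (poset_reflection P)"

definition heyting_prealgebra_map :: "'x gorder \<Rightarrow> 'y gorder \<Rightarrow> ('x \<Rightarrow> 'y) \<Rightarrow> bool" where
  "heyting_prealgebra_map P Q f \<longleftrightarrow> monotone_map P Q f \<and>
     heyting_hom (poset_reflection P) (poset_reflection Q) (reflection_map Q f)"


section \<open>The category of sets\<close>

text \<open>
  The category Set is played by the full category of sets and functions on a family \<open>U\<close> of sets
  over a type \<open>'u\<close>. All that is asked of \<open>U\<close> is closure under subsets and, up to bijection, binary
  products (hence under pullbacks); these hold for every Grothendieck universe, and also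
  for all sets over an infinite type. A morphism from \<open>X\<close> to \<open>Y\<close> is an element of
  \<open>X \<rightarrow>\<^sub>E Y\<close>, i.e. a function with the value \<open>undefined\<close> outside \<open>X\<close>, so that
  equality of morphisms is equality in HOL.
\<close>

definition set_universe :: "'u set set \<Rightarrow> bool" where
  "set_universe U \<longleftrightarrow>
     (\<forall>X\<in>U. \<forall>Y. Y \<subseteq> X \<longrightarrow> Y \<in> U) \<and>
     (\<forall>X\<in>U. \<forall>Y\<in>U. \<exists>Z\<in>U. \<exists>h. bij_betw h (X \<times> Y) Z)"

lemma set_universe_UNIV:
  assumes "infinite (UNIV :: 'u set)"
  shows "set_universe (UNIV :: 'u set set)"
proof -
  obtain p :: "'u \<times> 'u \<Rightarrow> 'u" where "bij_betw p (UNIV \<times> UNIV) UNIV"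
    using card_of_Times_same_infinite[OF assms] unfolding card_of_ordIso[symmetric] by blast
  then have "inj p" by (simp add: bij_betw_def)
  then have "bij_betw p (X \<times> Y) (p ` (X \<times> Y))" for X Y
    by (meson bij_betw_def inj_on_subset subset_UNIV)
  then show ?thesis unfolding set_universe_def by blast
qed

definition pullback_square ::
  "'u set \<Rightarrow> 'u set \<Rightarrow> 'u set \<Rightarrow> 'u set \<Rightarrow>
   ('u \<Rightarrow> 'u) \<Rightarrow> ('u \<Rightarrow> 'u) \<Rightarrow> ('u \<Rightarrow> 'u) \<Rightarrow> ('u \<Rightarrow> 'u) \<Rightarrow> bool" where
  "pullback_square W X Y Z p q f g \<longleftrightarrow>
     p \<in> W \<rightarrow>\<^sub>E X \<and> q \<in> W \<rightarrow>\<^sub>E Y \<and> f \<in> X \<rightarrow>\<^sub>E Z \<and> g \<in> Y \<rightarrow>\<^sub>E Z \<and>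
     bij_betw (\<lambda>w. (p w, q w)) W {(x, y) \<in> X \<times> Y. f x = g y}"


section \<open>Triposes\<close>

text \<open>\<open>reindex P X Y f\<close> is the map \<open>P(f)\<close> from the fibre over \<open>Y\<close> to the fibre over \<open>X\<close>,
  for \<open>f\<close> from \<open>X\<close> to \<open>Y\<close>.\<close>

record ('u, 'p) indexed_preorder =
  fibre :: "'u set \<Rightarrow> 'p gorder"
  reindex :: "'u set \<Rightarrow> 'u set \<Rightarrow> ('u \<Rightarrow> 'u) \<Rightarrow> 'p \<Rightarrow> 'p"

text \<open>Since the fibres are preorders, the coherence isomorphisms of a pseudofunctor need only exist.\<close>

definition heyting_pseudofunctor :: "'u set set \<Rightarrow> ('u, 'p) indexed_preorder \<Rightarrow> bool" where
  "heyting_pseudofunctor U P \<longleftrightarrow>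
     (\<forall>X\<in>U. heyting_prealgebra (fibre P X)) \<and>
     (\<forall>X\<in>U. \<forall>Y\<in>U. \<forall>f\<in>X \<rightarrow>\<^sub>E Y.
        heyting_prealgebra_map (fibre P Y) (fibre P X) (reindex P X Y f)) \<and>
     (\<forall>X\<in>U. \<forall>\<phi>\<in>carrier (fibre P X). reindex P X X (\<lambda>x\<in>X. x) \<phi> .=\<^bsub>fibre P X\<^esub> \<phi>) \<and>
     (\<forall>X\<in>U. \<forall>Y\<in>U. \<forall>Z\<in>U. \<forall>f\<in>X \<rightarrow>\<^sub>E Y. \<forall>g\<in>Y \<rightarrow>\<^sub>E Z. \<forall>\<phi>\<in>carrier (fibre P Z).
        reindex P X Z (compose X g f) \<phi> .=\<^bsub>fibre P X\<^esub> reindex P X Y f (reindex P Y Z g \<phi>))"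

definition has_quantifiers :: "'u set set \<Rightarrow> ('u, 'p) indexed_preorder \<Rightarrow> bool" where
  "has_quantifiers U P \<longleftrightarrow>
     (\<exists>ex all.
        (\<forall>X\<in>U. \<forall>Y\<in>U. \<forall>f\<in>X \<rightarrow>\<^sub>E Y.
           adjoint_maps (fibre P X) (fibre P Y) (ex X Y f) (reindex P X Y f) \<and>
           adjoint_maps (fibre P Y) (fibre P X) (reindex P X Y f) (all X Y f)) \<and>
        (\<forall>W\<in>U. \<forall>X\<in>U. \<forall>Y\<in>U. \<forall>Z\<in>U. \<forall>p q f g. pullback_square W X Y Z p q f g \<longrightarrow>
           (\<forall>\<phi>\<in>carrier (fibre P X).
              reindex P Y Z g (ex X Z f \<phi>) .=\<^bsub>fibre P Y\<^esub> ex W Y q (reindex P W X p \<phi>) \<and>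
              reindex P Y Z g (all X Z f \<phi>) .=\<^bsub>fibre P Y\<^esub> all W Y q (reindex P W X p \<phi>))))"

definition has_generic_element :: "'u set set \<Rightarrow> ('u, 'p) indexed_preorder \<Rightarrow> bool" where
  "has_generic_element U P \<longleftrightarrow>
     (\<exists>\<Sigma>\<in>U. \<exists>\<sigma>\<in>carrier (fibre P \<Sigma>). \<forall>X\<in>U. \<forall>\<phi>\<in>carrier (fibre P X).
        \<exists>g\<in>X \<rightarrow>\<^sub>E \<Sigma>. \<phi> .=\<^bsub>fibre P X\<^esub> reindex P X \<Sigma> g \<sigma>)"

definition tripos :: "'u set set \<Rightarrow> ('u, 'p) indexed_preorder \<Rightarrow> bool" where
  "tripos U P \<longleftrightarrow> heyting_pseudofunctor U P \<and> has_quantifiers U P \<and> has_generic_element U P"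


section \<open>Transformations\<close>

type_synonym ('u, 'p, 'q) transformation = "'u set \<Rightarrow> 'p \<Rightarrow> 'q"

definition is_transformation ::
  "'u set set \<Rightarrow> ('u, 'p) indexed_preorder \<Rightarrow> ('u, 'q) indexed_preorder
   \<Rightarrow> ('u, 'p, 'q) transformation \<Rightarrow> bool" where
  "is_transformation U P Q \<Phi> \<longleftrightarrow>
     (\<forall>X\<in>U. monotone_map (fibre P X) (fibre Q X) (\<Phi> X)) \<and>
     (\<forall>X\<in>U. \<forall>Y\<in>U. \<forall>f\<in>X \<rightarrow>\<^sub>E Y. \<forall>\<phi>\<in>carrier (fibre P Y).
        \<Phi> X (reindex P X Y f \<phi>) .=\<^bsub>fibre Q X\<^esub> reindex Q X Y f (\<Phi> Y \<phi>))"

definition trans_le ::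
  "'u set set \<Rightarrow> ('u, 'p) indexed_preorder \<Rightarrow> ('u, 'q) indexed_preorder
   \<Rightarrow> ('u, 'p, 'q) transformation \<Rightarrow> ('u, 'p, 'q) transformation \<Rightarrow> bool" where
  "trans_le U P Q \<Phi> \<Psi> \<longleftrightarrow> (\<forall>X\<in>U. \<forall>\<phi>\<in>carrier (fibre P X). \<Phi> X \<phi> \<sqsubseteq>\<^bsub>fibre Q X\<^esub> \<Psi> X \<phi>)"

definition trans_iso ::
  "'u set set \<Rightarrow> ('u, 'p) indexed_preorder \<Rightarrow> ('u, 'q) indexed_preorder
   \<Rightarrow> ('u, 'p, 'q) transformation \<Rightarrow> ('u, 'p, 'q) transformation \<Rightarrow> bool" where
  "trans_iso U P Q \<Phi> \<Psi> \<longleftrightarrow> trans_le U P Q \<Phi> \<Psi> \<and> trans_le U P Q \<Psi> \<Phi>"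

definition trans_id :: "('u, 'p, 'p) transformation" where
  "trans_id X \<phi> = \<phi>"

definition trans_comp ::
  "('u, 'q, 'r) transformation \<Rightarrow> ('u, 'p, 'q) transformation \<Rightarrow> ('u, 'p, 'r) transformation" where
  "trans_comp \<Psi> \<Phi> X \<phi> = \<Psi> X (\<Phi> X \<phi>)"

definition cartesian_transformation ::
  "'u set set \<Rightarrow> ('u, 'p) indexed_preorder \<Rightarrow> ('u, 'q) indexed_preorder
   \<Rightarrow> ('u, 'p, 'q) transformation \<Rightarrow> bool" where
  "cartesian_transformation U P Q \<Phi> \<longleftrightarrow> is_transformation U P Q \<Phi> \<and>
     (\<forall>X\<in>U. preserves_finite_meets (fibre P X) (fibre Q X) (\<Phi> X))"

definition closure_transformation ::
  "'u set set \<Rightarrow> ('u, 'p) indexed_preorder \<Rightarrow> ('u, 'p, 'p) transformation \<Rightarrow> bool" where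
  "closure_transformation U P \<Phi> \<longleftrightarrow> cartesian_transformation U P P \<Phi> \<and>
     trans_le U P P trans_id \<Phi> \<and> trans_iso U P P (trans_comp \<Phi> \<Phi>) \<Phi>"

definition ClTrans ::
  "'u set set \<Rightarrow> ('u, 'p) indexed_preorder \<Rightarrow> ('u, 'p, 'p) transformation gorder" where
  "ClTrans U P = preorder_of {\<Phi>. closure_transformation U P \<Phi>} (trans_le U P P)"


section \<open>Geometric morphisms and subtriposes\<close>

text \<open>\<open>geometric_morphism U Q P (I, D)\<close>: a geometric morphism from \<open>Q\<close> to \<open>P\<close> with inverse
  image \<open>I\<close> (upper plus) and direct image \<open>D\<close> (lower plus).\<close>

type_synonym ('u, 'q, 'p) geometric = "('u, 'p, 'q) transformation \<times> ('u, 'q, 'p) transformation"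

definition geometric_morphism ::
  "'u set set \<Rightarrow> ('u, 'q) indexed_preorder \<Rightarrow> ('u, 'p) indexed_preorder
   \<Rightarrow> ('u, 'q, 'p) geometric \<Rightarrow> bool" where
  "geometric_morphism U Q P \<Phi> \<longleftrightarrow> tripos U Q \<and> tripos U P \<and>
     cartesian_transformation U P Q (fst \<Phi>) \<and> is_transformation U Q P (snd \<Phi>) \<and>
     (\<forall>X\<in>U. adjoint_maps (fibre P X) (fibre Q X) (fst \<Phi> X) (snd \<Phi> X))"

definition geometric_inclusion ::
  "'u set set \<Rightarrow> ('u, 'q) indexed_preorder \<Rightarrow> ('u, 'p) indexed_preorder
   \<Rightarrow> ('u, 'q, 'p) geometric \<Rightarrow> bool" where
  "geometric_inclusion U Q P \<Phi> \<longleftrightarrow> geometric_morphism U Q P \<Phi> \<and>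
     trans_iso U Q Q (trans_comp (fst \<Phi>) (snd \<Phi>)) trans_id"

text \<open>The elements of the fibres of the subtriposes range over a type \<open>'q\<close>, which can be any type
  large enough for the subtriposes that one wants to have.\<close>

definition SubTrip ::
  "'u set set \<Rightarrow> ('u, 'p) indexed_preorder
   \<Rightarrow> (('u, 'q) indexed_preorder \<times> ('u, 'q, 'p) geometric) gorder" where
  "SubTrip U P = preorder_of {(Q, \<Phi>). geometric_inclusion U Q P \<Phi>}
     (\<lambda>(Q, \<Phi>) (R, \<Psi>). \<exists>\<Theta>. geometric_morphism U Q R \<Theta> \<and>
        trans_iso U Q P (snd \<Phi>) (trans_comp (snd \<Psi>) (snd \<Theta>)))"


section \<open>Arrow algebras\<close>

text \<open>A poset with all meets is given by a type of class \<open>complete_lattice\<close>; only its order and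
  its meets are used.\<close>

record 'a arrow_structure =
  arrow :: "'a \<Rightarrow> 'a \<Rightarrow> 'a" (infixr \<open>\<leadsto>\<index>\<close> 65)
  separator :: "'a set"

definition comb_k :: "'a::complete_lattice arrow_structure \<Rightarrow> 'a" where
  "comb_k A = (INF a. INF b. a \<leadsto>\<^bsub>A\<^esub> b \<leadsto>\<^bsub>A\<^esub> a)"

definition comb_s :: "'a::complete_lattice arrow_structure \<Rightarrow> 'a" where
  "comb_s A = (INF a. INF b. INF c.
     (a \<leadsto>\<^bsub>A\<^esub> b \<leadsto>\<^bsub>A\<^esub> c) \<leadsto>\<^bsub>A\<^esub> (a \<leadsto>\<^bsub>A\<^esub> b) \<leadsto>\<^bsub>A\<^esub> a \<leadsto>\<^bsub>A\<^esub> c)"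

text \<open>A pair of families over a common index set enters only through the set \<open>R\<close> of its pairs of
  values, and every \<open>R\<close> is such a set.\<close>

definition comb_a :: "'a::complete_lattice arrow_structure \<Rightarrow> 'a" where
  "comb_a A = (INF a. INF R :: ('a \<times> 'a) set.
     (INF (b, c)\<in>R. a \<leadsto>\<^bsub>A\<^esub> b \<leadsto>\<^bsub>A\<^esub> c) \<leadsto>\<^bsub>A\<^esub> a \<leadsto>\<^bsub>A\<^esub> (INF (b, c)\<in>R. b \<leadsto>\<^bsub>A\<^esub> c))"

definition arrow_algebra :: "'a::complete_lattice arrow_structure \<Rightarrow> bool" where
  "arrow_algebra A \<longleftrightarrow>
     (\<forall>a a' b b'. a' \<le> a \<and> b \<le> b' \<longrightarrow> (a \<leadsto>\<^bsub>A\<^esub> b) \<le> (a' \<leadsto>\<^bsub>A\<^esub> b')) \<and>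
     (\<forall>a b. a \<in> separator A \<and> a \<le> b \<longrightarrow> b \<in> separator A) \<and>
     (\<forall>a b. (a \<leadsto>\<^bsub>A\<^esub> b) \<in> separator A \<and> a \<in> separator A \<longrightarrow> b \<in> separator A) \<and>
     comb_k A \<in> separator A \<and> comb_s A \<in> separator A \<and> comb_a A \<in> separator A"

definition entails ::
  "'a::complete_lattice arrow_structure \<Rightarrow> 'i set \<Rightarrow> ('i \<Rightarrow> 'a) \<Rightarrow> ('i \<Rightarrow> 'a) \<Rightarrow> bool" where
  "entails A I \<phi> \<psi> \<longleftrightarrow> (INF i\<in>I. \<phi> i \<leadsto>\<^bsub>A\<^esub> \<psi> i) \<in> separator A"

definition arrow_tripos ::
  "'a::complete_lattice arrow_structure \<Rightarrow> ('u, 'u \<Rightarrow> 'a) indexed_preorder" where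
  "arrow_tripos A =
     \<lparr>fibre = (\<lambda>I. preorder_of (I \<rightarrow>\<^sub>E UNIV) (entails A I)),
      reindex = (\<lambda>I J f \<phi>. compose I \<phi> f)\<rparr>"

definition implicative_morphism ::
  "'a::complete_lattice arrow_structure \<Rightarrow> 'b::complete_lattice arrow_structure
   \<Rightarrow> ('a \<Rightarrow> 'b) \<Rightarrow> bool" where
  "implicative_morphism A B f \<longleftrightarrow>
     (\<forall>a\<in>separator A. f a \<in> separator B) \<and>
     (\<exists>r\<in>separator B. \<forall>a a'. r \<le> (f (a \<leadsto>\<^bsub>A\<^esub> a') \<leadsto>\<^bsub>B\<^esub> f a \<leadsto>\<^bsub>B\<^esub> f a')) \<and>
     (\<forall>X :: ('a \<times> 'a) set. (INF (a, a')\<in>X. a \<leadsto>\<^bsub>A\<^esub> a') \<in> separator A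
        \<longrightarrow> (INF (a, a')\<in>X. f a \<leadsto>\<^bsub>B\<^esub> f a') \<in> separator B)"

text \<open>The transformation of arrow triposes induced by an implicative morphism, namely
  postcomposition.\<close>

definition induced_transformation ::
  "('a \<Rightarrow> 'b) \<Rightarrow> ('u, 'u \<Rightarrow> 'a, 'u \<Rightarrow> 'b) transformation" where
  "induced_transformation f I \<phi> = compose I f \<phi>"

definition nucleus :: "'a::complete_lattice arrow_structure \<Rightarrow> ('a \<Rightarrow> 'a) \<Rightarrow> bool" where
  "nucleus A j \<longleftrightarrow>
     (\<forall>a b. a \<le> b \<longrightarrow> j a \<le> j b) \<and>
     (INF a. a \<leadsto>\<^bsub>A\<^esub> j a) \<in> separator A \<and>
     (INF a. INF b. (a \<leadsto>\<^bsub>A\<^esub> j b) \<leadsto>\<^bsub>A\<^esub> j a \<leadsto>\<^bsub>A\<^esub> j b) \<in> separator A"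

text \<open>The order is that of the fibre of the arrow tripos over the set of all elements of the
  algebra.\<close>

definition nuclei :: "'a::complete_lattice arrow_structure \<Rightarrow> ('a \<Rightarrow> 'a) gorder" where
  "nuclei A = preorder_of {j. nucleus A j} (entails A UNIV)"

end

theory Submission
  imports Defs
begin

text \<open>
  Entailment in an arrow algebra, uniform over an index set, is a constructive logic: the combinators \<open>k\<close> and \<open>s\<close>
  give implication, and \<open>a\<close> gives generalization over an index. Conjunction, disjunction and
  the quantifiers are then definable, and a nucleus \<open>j\<close> is a strong monad in this logic, with unit
  \<open>a \<leadsto> j a\<close> and bind \<open>(a \<leadsto> j b) \<leadsto> j a \<leadsto> j b\<close>. Everything else is deduced with these rules.

  For closure transformations, postcomposition with a nucleus is one because a strong monad
  with the bind law preserves conjunctions and is idempotent. Conversely, a closure transformation \<open>\<Phi>\<close> of the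
  arrow tripos is determined by its value at the generic element, which is a map \<open>f\<close> from the
  algebra to itself; evaluating \<open>\<Phi>\<close> at projections from sets of pairs shows that \<open>f\<close> satisfies
  the laws of a nucleus up to entailment. The map \<open>f\<close> need not be monotone for the order of the
  algebra, but it is isomorphic to \<open>a \<mapsto> (INF a'\<in>{a..}. true \<leadsto> f a')\<close>, which is
  monotone (\<open>nucleus_of_lex_map\<close>, \<open>nucleus_of_closure_transformation\<close>). Since the order of transformations can
  also be tested at the generic element (\<open>entails_iff_induced_le\<close>), this is an equivalence.

  For subtriposes, an inclusion \<open>\<Phi>\<close> has the closure transformation \<open>\<Phi>\<^sub>+ \<Phi>\<^sup>+\<close>, and over any tripos one
  inclusion factors through another iff the closure transformations are related in the opposite
  direction (\<open>subtripos_le_iff_closure_ge\<close>). It remains to realize each nucleus \<open>j\<close> by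
  an inclusion. The subtripos consists of the same families, ordered by \<open>\<phi>\<close> entails \<open>j \<circ> \<psi>\<close>; its
  tripos structure is that of the arrow tripos with \<open>j\<close> inserted in implications and universal
  quantifiers (\<open>tripos_closed_tripos\<close>, \<open>geometric_inclusion_sheafification\<close>).
\<close>

section \<open>Preorders and Heyting prealgebras\<close>

lemma preorder_of_simps [simp]:
  "carrier (preorder_of X r) = X"
  "x \<sqsubseteq>\<^bsub>preorder_of X r\<^esub> y \<longleftrightarrow> r x y"
  "x .=\<^bsub>preorder_of X r\<^esub> y \<longleftrightarrow> r x y \<and> r y x"
  by (simp_all add: preorder_of_def)

lemma weak_partial_order_preorder_of:
  assumes "\<And>x. x \<in> X \<Longrightarrow> r x x"
    and "\<And>x y z. \<lbrakk>r x y; r y z; x \<in> X; y \<in> X; z \<in> X\<rbrakk> \<Longrightarrow> r x z"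
  shows "weak_partial_order (preorder_of X r)"
  by unfold_locales (auto intro: assms(1) assms(2))

lemma (in weak_partial_order) eq_iff_le_le:
  "x \<in> carrier L \<Longrightarrow> y \<in> carrier L \<Longrightarrow> x .= y \<longleftrightarrow> x \<sqsubseteq> y \<and> y \<sqsubseteq> x"
  by (meson sym weak_le_antisym weak_refl)

text \<open>
  A quasi-inverse chooses preimages up to isomorphism. The relation \<open>r\<close>, being pulled back from
  \<open>Q\<close>, inherits reflexivity and transitivity. This makes the inclusion relation between subtriposes a preorder without composing geometric morphisms.
\<close>

lemma preorder_equivalence_of_embedding:
  assumes Q: "weak_partial_order Q" and F: "F \<in> X \<rightarrow> carrier Q"
    and r: "\<And>x y. x \<in> X \<Longrightarrow> y \<in> X \<Longrightarrow> r x y \<longleftrightarrow> F x \<sqsubseteq>\<^bsub>Q\<^esub> F y"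
    and surj: "\<And>q. q \<in> carrier Q \<Longrightarrow> \<exists>x\<in>X. F x .=\<^bsub>Q\<^esub> q"
  shows "preorder_equivalence (preorder_of X r) Q F"
proof -
  interpret Q: weak_partial_order Q by (rule Q)
  define G where "G q = (SOME x. x \<in> X \<and> F x .=\<^bsub>Q\<^esub> q)" for q
  have G: "G q \<in> X" "F (G q) .=\<^bsub>Q\<^esub> q" if "q \<in> carrier Q" for q
    using someI_ex[of "\<lambda>x. x \<in> X \<and> F x .=\<^bsub>Q\<^esub> q"] surj[OF that] unfolding G_def by blast+
  have FX: "F x \<in> carrier Q" if "x \<in> X" for x using F that by auto
  have P: "weak_partial_order (preorder_of X r)"
  proof (rule weak_partial_order_preorder_of)
    show "r x x" if "x \<in> X" for x using that FX by (simp add: r)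
    show "r x z" if "r x y" "r y z" "x \<in> X" "y \<in> X" "z \<in> X" for x y z
      using that FX Q.le_trans[of "F x" "F y" "F z"] by (simp add: r)
  qed
  have "monotone_map Q (preorder_of X r) G"
    unfolding monotone_map_def isotone_def
  proof (intro conjI ballI impI P Q)
    fix p q assume pq: "p \<in> carrier Q" "q \<in> carrier Q" "p \<sqsubseteq>\<^bsub>Q\<^esub> q"
    have "F (G p) \<sqsubseteq>\<^bsub>Q\<^esub> F (G q)"
      using pq G FX Q.le_cong by meson
    then show "G p \<sqsubseteq>\<^bsub>preorder_of X r\<^esub> G q" using pq G r by simp
  qed (use G in auto)
  moreover have "monotone_map (preorder_of X r) Q F"
    unfolding monotone_map_def isotone_def using P Q F r by auto
  moreover have "G (F x) .=\<^bsub>preorder_of X r\<^esub> x" if "x \<in> X" for x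
    using that G[OF FX[OF that]] r FX by (auto simp: Q.eq_iff_le_le simp del: Q.weak_refl)
  ultimately show ?thesis
    unfolding preorder_equivalence_def using G by auto
qed

lemma greatest_Lower_iff:
  assumes "F \<subseteq> carrier P"
  shows "greatest P m (Lower P F) \<longleftrightarrow> m \<in> carrier P \<and> (\<forall>x\<in>F. m \<sqsubseteq>\<^bsub>P\<^esub> x) \<and>
    (\<forall>z\<in>carrier P. (\<forall>x\<in>F. z \<sqsubseteq>\<^bsub>P\<^esub> x) \<longrightarrow> z \<sqsubseteq>\<^bsub>P\<^esub> m)"
  using assms unfolding greatest_def Lower_def by blast

lemma least_Upper_iff:
  assumes "F \<subseteq> carrier P"
  shows "least P m (Upper P F) \<longleftrightarrow> m \<in> carrier P \<and> (\<forall>x\<in>F. x \<sqsubseteq>\<^bsub>P\<^esub> m) \<and>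
    (\<forall>z\<in>carrier P. (\<forall>x\<in>F. x \<sqsubseteq>\<^bsub>P\<^esub> z) \<longrightarrow> m \<sqsubseteq>\<^bsub>P\<^esub> z)"
  using assms unfolding least_def Upper_def by blast

text \<open>
  Operations on the preorder itself, with laws up to isomorphism. Their classes are the operations
  of the poset reflection, so that the choices by which joins, meets and implications
  of a poset are described there can be evaluated.
\<close>

locale heyting_operations = weak_partial_order P for P :: "'a gorder" (structure) +
  fixes t b :: 'a and m u i :: "'a \<Rightarrow> 'a \<Rightarrow> 'a"
  assumes ops_closed: "t \<in> carrier P" "b \<in> carrier P"
      "\<And>x y. \<lbrakk>x \<in> carrier P; y \<in> carrier P\<rbrakk> \<Longrightarrow> m x y \<in> carrier P"
      "\<And>x y. \<lbrakk>x \<in> carrier P; y \<in> carrier P\<rbrakk> \<Longrightarrow> u x y \<in> carrier P"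
      "\<And>x y. \<lbrakk>x \<in> carrier P; y \<in> carrier P\<rbrakk> \<Longrightarrow> i x y \<in> carrier P"
    and top: "x \<in> carrier P \<Longrightarrow> x \<sqsubseteq> t"
    and bot: "x \<in> carrier P \<Longrightarrow> b \<sqsubseteq> x"
    and meet: "\<lbrakk>x \<in> carrier P; y \<in> carrier P; z \<in> carrier P\<rbrakk> \<Longrightarrow> z \<sqsubseteq> m x y \<longleftrightarrow> z \<sqsubseteq> x \<and> z \<sqsubseteq> y"
    and join: "\<lbrakk>x \<in> carrier P; y \<in> carrier P; z \<in> carrier P\<rbrakk> \<Longrightarrow> u x y \<sqsubseteq> z \<longleftrightarrow> x \<sqsubseteq> z \<and> y \<sqsubseteq> z"
    and imp: "\<lbrakk>x \<in> carrier P; y \<in> carrier P; z \<in> carrier P\<rbrakk> \<Longrightarrow> z \<sqsubseteq> i x y \<longleftrightarrow> m z x \<sqsubseteq> y"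
begin

lemma class_eq_iff: "\<lbrakk>x \<in> carrier P; y \<in> carrier P\<rbrakk> \<Longrightarrow> class_of x = class_of y \<longleftrightarrow> x .= y"
  unfolding eq_class_of_def by (auto intro: trans sym)

lemma reflection_simps:
  "carrier (poset_reflection P) = class_of ` carrier P"
  "C .=\<^bsub>poset_reflection P\<^esub> D \<longleftrightarrow> C = D"
  by (auto simp: poset_reflection_def eq_classes_def)

lemma reflection_le:
  assumes "x \<in> carrier P" "y \<in> carrier P"
  shows "class_of x \<sqsubseteq>\<^bsub>poset_reflection P\<^esub> class_of y \<longleftrightarrow> x \<sqsubseteq> y"
  using assms unfolding poset_reflection_def eq_class_of_def
  by (auto simp: le_cong[of x _ y])

lemma partial_order_reflection: "partial_order (poset_reflection P)"
proof
  fix C D E assume "C \<sqsubseteq>\<^bsub>poset_reflection P\<^esub> D" "D \<sqsubseteq>\<^bsub>poset_reflection P\<^esub> E"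
    "C \<in> carrier (poset_reflection P)" "D \<in> carrier (poset_reflection P)" "E \<in> carrier (poset_reflection P)"
  then show "C \<sqsubseteq>\<^bsub>poset_reflection P\<^esub> E"
    by (clarsimp simp: reflection_simps reflection_le) (rule le_trans)
next
  fix C D assume "C \<sqsubseteq>\<^bsub>poset_reflection P\<^esub> D" "D \<sqsubseteq>\<^bsub>poset_reflection P\<^esub> C"
    "C \<in> carrier (poset_reflection P)" "D \<in> carrier (poset_reflection P)"
  then show "C .=\<^bsub>poset_reflection P\<^esub> D"
    by (clarsimp simp: reflection_simps reflection_le class_eq_iff eq_iff_le_le simp del: weak_refl)
qed (auto simp: reflection_simps reflection_le fun_eq_iff)

sublocale R: partial_order "poset_reflection P"
  by (rule partial_order_reflection)

lemma least_reflection: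
  assumes "x \<in> carrier P" "y \<in> carrier P"
  shows "least (poset_reflection P) (class_of (u x y)) (Upper (poset_reflection P) {class_of x, class_of y})"
  using assms join[OF assms] join[OF assms, of "u x y"] ops_closed
  by (subst least_Upper_iff) (auto simp: reflection_simps reflection_le)

lemma greatest_reflection:
  assumes "x \<in> carrier P" "y \<in> carrier P"
  shows "greatest (poset_reflection P) (class_of (m x y)) (Lower (poset_reflection P) {class_of x, class_of y})"
  using assms meet[OF assms] meet[OF assms, of "m x y"] ops_closed
  by (subst greatest_Lower_iff) (auto simp: reflection_simps reflection_le)

lemma reflection_bot_least: "least (poset_reflection P) (class_of b) (carrier (poset_reflection P))"
  using bot ops_closed by (auto simp: least_def reflection_simps reflection_le)

lemma reflection_top_greatest: "greatest (poset_reflection P) (class_of t) (carrier (poset_reflection P))"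
  using top ops_closed by (auto simp: greatest_def reflection_simps reflection_le)

lemma bounded_lattice_reflection: "bounded_lattice (poset_reflection P)"
proof
  fix C D assume CD: "C \<in> carrier (poset_reflection P)" "D \<in> carrier (poset_reflection P)"
  then obtain x y where xy: "x \<in> carrier P" "y \<in> carrier P" "C = class_of x" "D = class_of y"
    by (auto simp: reflection_simps)
  show "\<exists>s. least (poset_reflection P) s (Upper (poset_reflection P) {C, D})"
    unfolding xy using least_reflection[OF xy(1,2)] by blast
  show "\<exists>s. greatest (poset_reflection P) s (Lower (poset_reflection P) {C, D})"
    unfolding xy using greatest_reflection[OF xy(1,2)] by blast
qed (use reflection_bot_least reflection_top_greatest in blast)+

sublocale R: bounded_lattice "poset_reflection P"
  by (rule bounded_lattice_reflection)

lemma reflection_ops: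
  assumes "x \<in> carrier P" "y \<in> carrier P"
  shows "class_of x \<squnion>\<^bsub>poset_reflection P\<^esub> class_of y = class_of (u x y)"
    and "class_of x \<sqinter>\<^bsub>poset_reflection P\<^esub> class_of y = class_of (m x y)"
  unfolding join_def meet_def sup_def inf_def
  by (rule some_equality, rule least_reflection[OF assms],
      erule R.least_unique, rule least_reflection[OF assms])
    (rule some_equality, rule greatest_reflection[OF assms],
      erule R.greatest_unique, rule greatest_reflection[OF assms])

lemma reflection_bot: "\<bottom>\<^bsub>poset_reflection P\<^esub> = class_of b"
  using R.least_unique R.bottom_least reflection_bot_least by blast

lemma reflection_top: "\<top>\<^bsub>poset_reflection P\<^esub> = class_of t"
  using R.greatest_unique R.top_greatest reflection_top_greatest by blast

lemma reflection_pseudocomplement: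
  assumes "x \<in> carrier P" "y \<in> carrier P"
  shows "is_relative_pseudocomplement (poset_reflection P) (class_of x) (class_of y) (class_of (i x y))"
  using assms imp[OF assms] imp[OF assms, of "i x y"] ops_closed
  by (auto simp: is_relative_pseudocomplement_def greatest_def reflection_simps reflection_ops reflection_le)

lemma reflection_imp:
  assumes "x \<in> carrier P" "y \<in> carrier P"
  shows "heyting_imp (poset_reflection P) (class_of x) (class_of y) = class_of (i x y)"
  unfolding heyting_imp_def
  by (rule the_equality, rule reflection_pseudocomplement[OF assms])
    (unfold is_relative_pseudocomplement_def, erule R.greatest_unique,
      rule reflection_pseudocomplement[OF assms, unfolded is_relative_pseudocomplement_def])

lemma heyting_prealgebra: "heyting_prealgebra P"
  unfolding heyting_prealgebra_def heyting_algebra_def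
  using weak_partial_order_axioms bounded_lattice_reflection reflection_pseudocomplement
  by (auto simp: reflection_simps)

end

text \<open>
  The operations are preserved on the nose: below, they are computed pointwise and the maps
  precompose.
\<close>

lemma heyting_prealgebra_mapI:
  assumes P: "heyting_operations P t b m u i" and Q: "heyting_operations Q t' b' m' u' i'"
    and f: "monotone_map P Q f"
    and ops: "f t = t'" "f b = b'"
      "\<And>x y. x \<in> carrier P \<Longrightarrow> y \<in> carrier P \<Longrightarrow> f (m x y) = m' (f x) (f y)"
      "\<And>x y. x \<in> carrier P \<Longrightarrow> y \<in> carrier P \<Longrightarrow> f (u x y) = u' (f x) (f y)"
      "\<And>x y. x \<in> carrier P \<Longrightarrow> y \<in> carrier P \<Longrightarrow> f (i x y) = i' (f x) (f y)"
  shows "heyting_prealgebra_map P Q f"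
proof -
  interpret P: heyting_operations P t b m u i by (rule P)
  interpret Q: heyting_operations Q t' b' m' u' i' by (rule Q)
  have fc: "f x \<in> carrier Q" if "x \<in> carrier P" for x
    using f that by (auto simp: monotone_map_def)
  have map: "reflection_map Q f (class_of\<^bsub>P\<^esub> x) = class_of\<^bsub>Q\<^esub> (f x)" if x: "x \<in> carrier P" for x
  proof -
    have "class_of\<^bsub>Q\<^esub> (f y) = class_of\<^bsub>Q\<^esub> (f x)" if "y \<in> class_of\<^bsub>P\<^esub> x" for y
    proof -
      have y: "y \<in> carrier P" "x .=\<^bsub>P\<^esub> y" using that by (auto simp: eq_class_of_def)
      then show ?thesis using f x fc
        by (auto simp: monotone_map_def isotone_def Q.class_eq_iff Q.eq_iff_le_le P.eq_iff_le_le simp del: P.weak_refl Q.weak_refl)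
    qed
    moreover have "x \<in> class_of\<^bsub>P\<^esub> x" using x by (simp add: eq_class_of_def)
    ultimately show ?thesis unfolding reflection_map_def by blast
  qed
  show ?thesis
    unfolding heyting_prealgebra_map_def heyting_hom_def
    using f fc ops P.ops_closed
    by (auto simp: P.reflection_simps Q.reflection_simps map P.reflection_top Q.reflection_top
        P.reflection_bot Q.reflection_bot P.reflection_ops Q.reflection_ops
        P.reflection_imp Q.reflection_imp)
qed

section \<open>The uniform logic of an arrow algebra\<close>

definition valid :: "'a::complete_lattice arrow_structure \<Rightarrow> 'i set \<Rightarrow> ('i \<Rightarrow> 'a) \<Rightarrow> bool" where
  "valid A I p \<longleftrightarrow> (INF i\<in>I. p i) \<in> separator A"

text \<open>
  Entailment of a family from a list of families, read as iterated implication with the head of the list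
  innermost, so that discharging the head of the list is a definitional step. The guard
  \<open>top\<close> in front makes the whole formula an implication at every index, even over the
  empty list. This is what makes modus ponens admissible in all contexts: the combinator \<open>a\<close>
  moves meets across arrows only for families of implications.
\<close>

definition proves ::
  "'a::complete_lattice arrow_structure \<Rightarrow> 'i set \<Rightarrow> ('i \<Rightarrow> 'a) list \<Rightarrow> ('i \<Rightarrow> 'a) \<Rightarrow> bool" where
  "proves A I G p \<longleftrightarrow>
     valid A I (\<lambda>i. top_class.top \<leadsto>\<^bsub>A\<^esub> foldl (\<lambda>q g. g i \<leadsto>\<^bsub>A\<^esub> q) (p i) G)"

lemma proves_Cons: "proves A I (g # G) p \<longleftrightarrow> proves A I G (\<lambda>i. g i \<leadsto>\<^bsub>A\<^esub> p i)"
  by (simp add: proves_def)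

lemma proves_cong:
  assumes "\<And>i. i \<in> I \<Longrightarrow> map (\<lambda>g. g i) G = map (\<lambda>g. g i) H"
    and "\<And>i. i \<in> I \<Longrightarrow> p i = q i"
  shows "proves A I G p \<longleftrightarrow> proves A I H q"
proof -
  have fold: "foldl (\<lambda>q g. g i \<leadsto>\<^bsub>A\<^esub> q) x G = foldl (\<lambda>q a. a \<leadsto>\<^bsub>A\<^esub> q) x (map (\<lambda>g. g i) G)" for i x G
    by (induction G arbitrary: x) auto
  show ?thesis
    unfolding proves_def valid_def by (subst (1 2) fold) (simp add: assms cong: INF_cong)
qed

locale arrow_logic =
  fixes A :: "'a::complete_lattice arrow_structure" (structure)
  assumes arrow_algebra: "arrow_algebra A"
begin

abbreviation true :: 'a where "true \<equiv> top_class.top"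

lemma arrow_mono: "a' \<le> a \<Longrightarrow> b \<le> b' \<Longrightarrow> (a \<leadsto> b) \<le> (a' \<leadsto> b')"
  using arrow_algebra by (simp add: arrow_algebra_def)

lemma separator_up: "a \<in> separator A \<Longrightarrow> a \<le> b \<Longrightarrow> b \<in> separator A"
  using arrow_algebra unfolding arrow_algebra_def by blast

lemma separator_mp: "(a \<leadsto> b) \<in> separator A \<Longrightarrow> a \<in> separator A \<Longrightarrow> b \<in> separator A"
  using arrow_algebra unfolding arrow_algebra_def by blast

lemma combinators: "comb_k A \<in> separator A" "comb_s A \<in> separator A" "comb_a A \<in> separator A"
  using arrow_algebra by (simp_all add: arrow_algebra_def)

lemma valid_mono:
  assumes "valid A I p" and "\<And>k. k \<in> K \<Longrightarrow> \<exists>i\<in>I. p i \<le> q k"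
  shows "valid A K q"
  using assms(1) unfolding valid_def by (rule separator_up) (rule INF_mono[OF assms(2)])

lemma comb_k_le: "comb_k A \<le> (a \<leadsto> b \<leadsto> a)"
  unfolding comb_k_def by (rule INF_lower2[where i = a, OF UNIV_I], rule INF_lower2[where i = b, OF UNIV_I], simp)

lemma comb_s_le: "comb_s A \<le> ((a \<leadsto> b \<leadsto> c) \<leadsto> (a \<leadsto> b) \<leadsto> a \<leadsto> c)"
  unfolding comb_s_def by (rule INF_lower2[where i = a, OF UNIV_I], rule INF_lower2[where i = b, OF UNIV_I], rule INF_lower2[where i = c, OF UNIV_I], simp)

lemma comb_a_le:
  "comb_a A \<le> ((INF j\<in>J. a \<leadsto> b j \<leadsto> c j) \<leadsto> a \<leadsto> (INF j\<in>J. b j \<leadsto> c j))"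
proof -
  have "comb_a A \<le> ((INF (b, c)\<in>(\<lambda>j. (b j, c j)) ` J. a \<leadsto> b \<leadsto> c) \<leadsto> a \<leadsto>
      (INF (b, c)\<in>(\<lambda>j. (b j, c j)) ` J. b \<leadsto> c))"
    unfolding comb_a_def
    by (rule INF_lower2[where i = a, OF UNIV_I], rule INF_lower2[where i = "(\<lambda>j. (b j, c j)) ` J", OF UNIV_I], simp)
  then show ?thesis by (simp add: image_image)
qed

lemma valid_le: "c \<in> separator A \<Longrightarrow> (\<And>i. i \<in> I \<Longrightarrow> c \<le> p i) \<Longrightarrow> valid A I p"
  unfolding valid_def by (erule separator_up) (rule INF_greatest)

lemma valid_k: "valid A I (\<lambda>i. a i \<leadsto> b i \<leadsto> a i)"
  by (rule valid_le[OF combinators(1) comb_k_le])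

lemma valid_s: "valid A I (\<lambda>i. (a i \<leadsto> b i \<leadsto> c i) \<leadsto> (a i \<leadsto> b i) \<leadsto> a i \<leadsto> c i)"
  by (rule valid_le[OF combinators(2) comb_s_le])

lemma valid_a:
  "valid A I (\<lambda>i. (INF j\<in>J i. a i \<leadsto> b i j \<leadsto> c i j) \<leadsto> a i \<leadsto> (INF j\<in>J i. b i j \<leadsto> c i j))"
  by (rule valid_le[OF combinators(3) comb_a_le])

text \<open>
  Strengthening the premise to the meet \<open>INF i\<in>I. p i\<close> makes it independent of the index. The combinator
  \<open>a\<close> then pulls this meet out of the family, and modus ponens of the separator applies.
\<close>

lemma valid_mp:
  assumes "valid A I (\<lambda>i. p i \<leadsto> b i \<leadsto> c i)" and p: "valid A I p"
  shows "valid A I (\<lambda>i. b i \<leadsto> c i)"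
proof -
  have "valid A I (\<lambda>i. (INF i\<in>I. p i) \<leadsto> b i \<leadsto> c i)"
    by (rule valid_mono[OF assms(1)]) (meson INF_lower arrow_mono order_refl)
  then have "((INF i\<in>I. p i) \<leadsto> (INF i\<in>I. b i \<leadsto> c i)) \<in> separator A"
    unfolding valid_def by (rule separator_mp[OF separator_up[OF combinators(3) comb_a_le]])
  then show ?thesis
    using p unfolding valid_def by (rule separator_mp)
qed

text \<open>
  This is the combinator \<open>s k k\<close>.
\<close>

lemma valid_refl: "valid A I (\<lambda>i. p i \<leadsto> p i)"
  by (rule valid_mp[OF valid_mp[OF valid_s valid_k[where b = "\<lambda>i. p i \<leadsto> p i"]] valid_k])

lemma valid_true: "valid A I (\<lambda>i. true)"
  unfolding valid_def using separator_up[OF combinators(1)] by auto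

lemma proves_of_valid: "valid A I p \<Longrightarrow> proves A I G p"
proof (induction G arbitrary: p)
  case Nil
  then show ?case by (simp add: proves_def valid_mp[OF valid_k])
next
  case (Cons g G)
  then show ?case by (simp add: proves_Cons valid_mp[OF valid_k])
qed

lemma proves_mp: "proves A I G (\<lambda>i. p i \<leadsto> q i) \<Longrightarrow> proves A I G p \<Longrightarrow> proves A I G q"
proof (induction G arbitrary: p q)
  case Nil
  then show ?case by (auto simp: proves_def intro: valid_mp[OF valid_mp[OF valid_s]])
next
  case (Cons g G)
  have "proves A I G (\<lambda>i. (g i \<leadsto> p i \<leadsto> q i) \<leadsto> (g i \<leadsto> p i) \<leadsto> g i \<leadsto> q i)"
    by (rule proves_of_valid[OF valid_s])
  from Cons.IH[OF Cons.IH[OF this]] Cons.prems show ?case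
    by (simp add: proves_Cons)
qed

lemma proves_weaken1: "proves A I G p \<Longrightarrow> proves A I (g # G) p"
  unfolding proves_Cons by (rule proves_mp[OF proves_of_valid[OF valid_k]])

lemma proves_hyp: "p \<in> set G \<Longrightarrow> proves A I G p"
  by (induction G) (auto simp: proves_Cons intro: proves_of_valid[OF valid_refl]
      proves_weaken1[unfolded proves_Cons])

lemma proves_weaken: "proves A I G p \<Longrightarrow> set G \<subseteq> set H \<Longrightarrow> proves A I H p"
proof (induction G arbitrary: p)
  case Nil
  have "proves A I [] p \<Longrightarrow> proves A I H p" for H
    by (induction H) (auto intro: proves_weaken1)
  with Nil show ?case by simp
next
  case (Cons g G)
  then show ?case using proves_mp proves_hyp by (fastforce simp: proves_Cons)
qed

lemma proves_cut: "proves A I G p \<Longrightarrow> proves A I (p # G) q \<Longrightarrow> proves A I G q"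
  unfolding proves_Cons by (rule proves_mp)

lemma valid_iff_proves: "valid A I (\<lambda>i. p i \<leadsto> q i) \<longleftrightarrow> proves A I [p] q"
proof
  assume "proves A I [p] q"
  then have "valid A I (\<lambda>i. true \<leadsto> p i \<leadsto> q i)" by (simp add: proves_def)
  then show "valid A I (\<lambda>i. p i \<leadsto> q i)" by (rule valid_mp[OF _ valid_true])
qed (simp add: proves_Cons proves_of_valid)

lemma entails_iff_proves: "entails A I p q \<longleftrightarrow> proves A I [p] q"
  unfolding valid_iff_proves[symmetric] by (simp add: entails_def valid_def)

lemma proves_mono:
  assumes "proves A I G p" and "\<And>i. i \<in> I \<Longrightarrow> p i \<le> q i"
  shows "proves A I G q"
proof -
  have "valid A I (\<lambda>i. p i \<leadsto> q i)"
    using valid_refl[where p = p] by (rule valid_mono) (blast intro: arrow_mono assms(2))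
  from proves_mp[OF proves_of_valid[OF this] assms(1)] show ?thesis .
qed

lemma proves_true: "proves A I G (\<lambda>i. true)"
  by (rule proves_of_valid[OF valid_true])

text \<open>
  Any formula can be replaced by an equivalent implication. The connectives below quantify
  over such guarded formulas.
\<close>

lemma proves_guard: "proves A I G (\<lambda>i. true \<leadsto> p i) \<longleftrightarrow> proves A I G p"
  using proves_mp[OF _ proves_true] proves_weaken1[of I G p "\<lambda>_. true"]
  by (auto simp: proves_Cons)

lemma proves_reindex:
  assumes "proves A I G p" and "\<And>k. k \<in> K \<Longrightarrow> r k \<in> I"
  shows "proves A K (map (\<lambda>g k. g (r k)) G) (\<lambda>k. p (r k))"
proof -
  have fold: "foldl (\<lambda>q g. g k \<leadsto> q) x (map (\<lambda>g k. g (r k)) G) = foldl (\<lambda>q g. g (r k) \<leadsto> q) x G" for k x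
    by (induction G arbitrary: x) auto
  show ?thesis
    using assms(1) unfolding proves_def fold by (rule valid_mono) (use assms(2) in blast)
qed

text \<open>
  Generalization over an index \<open>j\<close> on which the assumptions do not depend. The meet is moved inwards past
  one assumption at a time by the combinator \<open>a\<close>, which is available only in front of implications;
  hence the form \<open>b \<leadsto> c\<close> of the conclusion.
\<close>

lemma proves_INF:
  assumes "proves A (Sigma I J) (map (\<lambda>g x. g (fst x)) G) (\<lambda>x. b (fst x) (snd x) \<leadsto> c (fst x) (snd x))"
  shows "proves A I G (\<lambda>i. INF j\<in>J i. b i j \<leadsto> c i j)"
  using assms
proof (induction G arbitrary: b c)
  case Nil
  have "valid A I (\<lambda>i. INF j\<in>J i. true \<leadsto> b i j \<leadsto> c i j)"
    using Nil unfolding valid_def proves_def by (auto elim!: separator_up intro!: INF_greatest INF_lower2)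
  then show ?case
    by (simp add: proves_def valid_mp[OF valid_a])
next
  case (Cons g G)
  have "proves A I G (\<lambda>i. INF j\<in>J i. g i \<leadsto> b i j \<leadsto> c i j)"
    using Cons.prems by (intro Cons.IH) (simp add: proves_Cons)
  then show ?case
    unfolding proves_Cons by (rule proves_mp[OF proves_of_valid[OF valid_a]])
qed

lemma proves_INF_D:
  assumes "proves A I G (\<lambda>i. INF j\<in>J i. p i j)" and "\<And>i. i \<in> I \<Longrightarrow> f i \<in> J i"
  shows "proves A I G (\<lambda>i. p i (f i))"
  using assms(1) by (rule proves_mono) (use assms(2) in \<open>auto intro: INF_lower\<close>)

lemma proves_falsum: "proves A I G (\<lambda>i. bot) \<Longrightarrow> proves A I G p"
  by (erule proves_mono) simp

text \<open>
  The second-order encodings of the connectives. The consequence \<open>c\<close> is guarded so that the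
  meets range over implications, as generalization requires.
\<close>

definition conj :: "'a \<Rightarrow> 'a \<Rightarrow> 'a" (infixr \<open>\<^bold>\<and>\<close> 67) where
  "a \<^bold>\<and> b = (INF c\<in>UNIV. (a \<leadsto> b \<leadsto> true \<leadsto> c) \<leadsto> true \<leadsto> c)"

definition disj :: "'a \<Rightarrow> 'a \<Rightarrow> 'a" (infixr \<open>\<^bold>\<or>\<close> 66) where
  "a \<^bold>\<or> b = (INF c\<in>UNIV. (a \<leadsto> true \<leadsto> c) \<leadsto> (b \<leadsto> true \<leadsto> c) \<leadsto> true \<leadsto> c)"

definition exists :: "'j set \<Rightarrow> ('j \<Rightarrow> 'a) \<Rightarrow> 'a" where
  "exists J p = (INF c\<in>UNIV. (INF j\<in>J. p j \<leadsto> true \<leadsto> c) \<leadsto> true \<leadsto> c)"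

definition forall :: "'j set \<Rightarrow> ('j \<Rightarrow> 'a) \<Rightarrow> 'a" where
  "forall J p = (INF j\<in>J. true \<leadsto> p j)"

lemma proves_conjI:
  assumes "proves A I G p" "proves A I G q"
  shows "proves A I G (\<lambda>i. p i \<^bold>\<and> q i)"
  unfolding conj_def
proof (rule proves_INF)
  let ?p = "\<lambda>x. p (fst x)" and ?q = "\<lambda>x. q (fst x)" and ?G = "map (\<lambda>g x. g (fst x)) G"
  let ?h = "\<lambda>x. ?p x \<leadsto> ?q x \<leadsto> true \<leadsto> snd x"
  have p: "proves A (I \<times> UNIV) (?h # ?G) ?p" and q: "proves A (I \<times> UNIV) (?h # ?G) ?q"
    by (auto intro!: proves_weaken1 proves_reindex[where r = fst] assms)
  have "proves A (I \<times> UNIV) (?h # ?G) ?h" by (simp add: proves_hyp)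
  from proves_mp[OF proves_mp[OF this p] q]
  have "proves A (I \<times> UNIV) (?h # ?G) (\<lambda>x. true \<leadsto> snd x)" .
  then show "proves A (I \<times> UNIV) ?G (\<lambda>x. ?h x \<leadsto> true \<leadsto> snd x)"
    by (simp add: proves_Cons)
qed

lemma proves_conjE:
  assumes "proves A I G (\<lambda>i. p i \<^bold>\<and> q i)" and "proves A I (q # p # G) r"
  shows "proves A I G r"
proof -
  have h: "proves A I G (\<lambda>i. (p i \<leadsto> q i \<leadsto> true \<leadsto> r i) \<leadsto> true \<leadsto> r i)"
    using assms(1) unfolding conj_def by (rule proves_INF_D) simp
  have k: "proves A I G (\<lambda>i. p i \<leadsto> q i \<leadsto> true \<leadsto> r i)"
    using iffD2[OF proves_guard assms(2)] by (simp only: proves_Cons)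
  show ?thesis using proves_mp[OF h k] by (simp only: proves_guard)
qed

lemma proves_disjI1:
  assumes "proves A I G p"
  shows "proves A I G (\<lambda>i. p i \<^bold>\<or> q i)"
  unfolding disj_def
proof (rule proves_INF)
  let ?p = "\<lambda>x. p (fst x)" and ?q = "\<lambda>x. q (fst x)" and ?G = "map (\<lambda>g x. g (fst x)) G"
  let ?h = "\<lambda>x. ?p x \<leadsto> true \<leadsto> snd x" and ?k = "\<lambda>x. ?q x \<leadsto> true \<leadsto> snd x"
  have p: "proves A (I \<times> UNIV) (?k # ?h # ?G) ?p"
    by (auto intro!: proves_weaken1 proves_reindex[where r = fst] assms)
  have "proves A (I \<times> UNIV) (?k # ?h # ?G) ?h" by (simp add: proves_hyp)
  from proves_mp[OF this p]
  have "proves A (I \<times> UNIV) (?k # ?h # ?G) (\<lambda>x. true \<leadsto> snd x)" .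
  then show "proves A (I \<times> UNIV) ?G (\<lambda>x. ?h x \<leadsto> ?k x \<leadsto> true \<leadsto> snd x)"
    by (simp add: proves_Cons)
qed

lemma proves_disjI2:
  assumes "proves A I G q"
  shows "proves A I G (\<lambda>i. p i \<^bold>\<or> q i)"
  unfolding disj_def
proof (rule proves_INF)
  let ?p = "\<lambda>x. p (fst x)" and ?q = "\<lambda>x. q (fst x)" and ?G = "map (\<lambda>g x. g (fst x)) G"
  let ?h = "\<lambda>x. ?p x \<leadsto> true \<leadsto> snd x" and ?k = "\<lambda>x. ?q x \<leadsto> true \<leadsto> snd x"
  have p: "proves A (I \<times> UNIV) (?k # ?h # ?G) ?q"
    by (auto intro!: proves_weaken1 proves_reindex[where r = fst] assms)
  have "proves A (I \<times> UNIV) (?k # ?h # ?G) ?k" by (simp add: proves_hyp)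
  from proves_mp[OF this p]
  have "proves A (I \<times> UNIV) (?k # ?h # ?G) (\<lambda>x. true \<leadsto> snd x)" .
  then show "proves A (I \<times> UNIV) ?G (\<lambda>x. ?h x \<leadsto> ?k x \<leadsto> true \<leadsto> snd x)"
    by (simp add: proves_Cons)
qed

lemma proves_disjE:
  assumes "proves A I G (\<lambda>i. p i \<^bold>\<or> q i)" and "proves A I (p # G) r" "proves A I (q # G) r"
  shows "proves A I G r"
proof -
  have h: "proves A I G (\<lambda>i. (p i \<leadsto> true \<leadsto> r i) \<leadsto> (q i \<leadsto> true \<leadsto> r i) \<leadsto> true \<leadsto> r i)"
    using assms(1) unfolding disj_def by (rule proves_INF_D) simp
  have k: "proves A I G (\<lambda>i. p i \<leadsto> true \<leadsto> r i)" "proves A I G (\<lambda>i. q i \<leadsto> true \<leadsto> r i)"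
    using iffD2[OF proves_guard assms(2)] iffD2[OF proves_guard assms(3)] by (simp_all only: proves_Cons)
  show ?thesis using proves_mp[OF proves_mp[OF h k(1)] k(2)] by (simp only: proves_guard)
qed

lemma proves_existsI:
  assumes "proves A I G (\<lambda>i. p i (f i))" and f: "\<And>i. i \<in> I \<Longrightarrow> f i \<in> J i"
  shows "proves A I G (\<lambda>i. exists (J i) (p i))"
  unfolding exists_def
proof (rule proves_INF)
  let ?p = "\<lambda>x. p (fst x) (f (fst x))" and ?G = "map (\<lambda>g x. g (fst x)) G"
  let ?h = "\<lambda>x. INF j\<in>J (fst x). p (fst x) j \<leadsto> true \<leadsto> snd x"
  have "proves A (I \<times> UNIV) (?h # ?G) ?p"
    by (rule proves_weaken1, rule proves_reindex[where r = fst, OF assms(1)]) auto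
  moreover have "proves A (I \<times> UNIV) (?h # ?G) ?h" by (simp add: proves_hyp)
  then have "proves A (I \<times> UNIV) (?h # ?G) (\<lambda>x. ?p x \<leadsto> true \<leadsto> snd x)"
    by (rule proves_INF_D) (use f in auto)
  ultimately have "proves A (I \<times> UNIV) (?h # ?G) (\<lambda>x. true \<leadsto> snd x)"
    by (rule proves_mp[rotated])
  then show "proves A (I \<times> UNIV) ?G (\<lambda>x. ?h x \<leadsto> true \<leadsto> snd x)"
    by (simp add: proves_Cons)
qed

lemma proves_existsE:
  assumes "proves A I G (\<lambda>i. exists (J i) (p i))"
    and "proves A (Sigma I J) ((\<lambda>x. p (fst x) (snd x)) # map (\<lambda>g x. g (fst x)) G) (\<lambda>x. r (fst x))"
  shows "proves A I G r"
proof -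
  have h: "proves A I G (\<lambda>i. (INF j\<in>J i. p i j \<leadsto> true \<leadsto> r i) \<leadsto> true \<leadsto> r i)"
    using assms(1) unfolding exists_def by (rule proves_INF_D) simp
  have k: "proves A I G (\<lambda>i. INF j\<in>J i. p i j \<leadsto> true \<leadsto> r i)"
    by (rule proves_INF) (use iffD2[OF proves_guard assms(2)] in \<open>simp only: proves_Cons\<close>)
  show ?thesis using proves_mp[OF h k] by (simp only: proves_guard)
qed

lemma proves_forallI:
  assumes "proves A (Sigma I J) (map (\<lambda>g x. g (fst x)) G) (\<lambda>x. p (fst x) (snd x))"
  shows "proves A I G (\<lambda>i. forall (J i) (p i))"
  unfolding forall_def by (rule proves_INF) (use assms in \<open>simp add: proves_guard\<close>)

lemma proves_forallD:
  assumes "proves A I G (\<lambda>i. forall (J i) (p i))" and "\<And>i. i \<in> I \<Longrightarrow> f i \<in> J i"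
  shows "proves A I G (\<lambda>i. p i (f i))"
  using proves_INF_D[OF assms[unfolded forall_def]] by (simp add: proves_guard)

end

text \<open>
  Inside the logic, a nucleus is a monad: the next two rules are its unit and its bind, and they are
  all that is used of it in deductions.
\<close>

locale nucleus_logic = arrow_logic +
  fixes j :: "'a \<Rightarrow> 'a"
  assumes nucleus: "nucleus A j"
begin

lemma proves_unit:
  assumes "proves A I G p"
  shows "proves A I G (\<lambda>i. j (p i))"
proof -
  have "(INF a. a \<leadsto> j a) \<in> separator A" using nucleus by (simp add: nucleus_def)
  then have "valid A I (\<lambda>i. p i \<leadsto> j (p i))" by (rule valid_le) (rule INF_lower, simp)
  from proves_mp[OF proves_of_valid[OF this] assms] show ?thesis .
qed

lemma proves_bind:
  assumes "proves A I G (\<lambda>i. j (p i))" and "proves A I (p # G) (\<lambda>i. j (q i))"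
  shows "proves A I G (\<lambda>i. j (q i))"
proof -
  have "(INF a. INF b. (a \<leadsto> j b) \<leadsto> j a \<leadsto> j b) \<in> separator A"
    using nucleus by (simp add: nucleus_def)
  then have "valid A I (\<lambda>i. (p i \<leadsto> j (q i)) \<leadsto> j (p i) \<leadsto> j (q i))"
    proof (rule valid_le)
    fix i
    show "(INF a. INF b. (a \<leadsto> j b) \<leadsto> j a \<leadsto> j b) \<le> ((p i \<leadsto> j (q i)) \<leadsto> j (p i) \<leadsto> j (q i))"
      by (rule INF_lower2[where i = "p i", OF UNIV_I], rule INF_lower2[where i = "q i", OF UNIV_I], simp)
  qed
  from proves_mp[OF proves_mp[OF proves_of_valid[OF this]] assms(1)] assms(2) show ?thesis
    by (simp add: proves_Cons)
qed

end

lemma (in arrow_logic) nucleus_id: "nucleus A id"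
proof -
  have "valid A UNIV (\<lambda>a. a \<leadsto> a)" by (rule valid_refl)
  moreover have "valid A UNIV (\<lambda>x. (fst x \<leadsto> snd x) \<leadsto> fst x \<leadsto> snd x)" by (rule valid_refl)
  then have "(INF a. INF b. (a \<leadsto> b) \<leadsto> a \<leadsto> b) \<in> separator A"
    unfolding valid_def
    by (rule separator_up) (auto intro!: INF_greatest INF_lower2[where i = "(a, b)" for a b])
  ultimately show ?thesis by (simp add: nucleus_def valid_def)
qed

section \<open>The tripos of a nucleus\<close>

lemma adjoint_mapsI:
  assumes P: "weak_partial_order P" and Q: "weak_partial_order Q"
    and l: "\<And>x. x \<in> carrier P \<Longrightarrow> l x \<in> carrier Q" and r: "\<And>y. y \<in> carrier Q \<Longrightarrow> r y \<in> carrier P"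
    and galois: "\<And>x y. x \<in> carrier P \<Longrightarrow> y \<in> carrier Q \<Longrightarrow> l x \<sqsubseteq>\<^bsub>Q\<^esub> y \<longleftrightarrow> x \<sqsubseteq>\<^bsub>P\<^esub> r y"
  shows "adjoint_maps P Q l r"
proof -
  interpret P: weak_partial_order P by (rule P)
  interpret Q: weak_partial_order Q by (rule Q)
  have "l x \<sqsubseteq>\<^bsub>Q\<^esub> l x'" if "x \<in> carrier P" "x' \<in> carrier P" "x \<sqsubseteq>\<^bsub>P\<^esub> x'" for x x'
    using P.le_trans[OF that(3) iffD1[OF galois[OF that(2) l[OF that(2)]]]] that
    by (simp add: galois l r)
  moreover have "r y \<sqsubseteq>\<^bsub>P\<^esub> r y'" if "y \<in> carrier Q" "y' \<in> carrier Q" "y \<sqsubseteq>\<^bsub>Q\<^esub> y'" for y y'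
    using Q.le_trans[OF iffD2[OF galois[OF r[OF that(1)] that(1)]] that(3)] that
    by (simp add: l r flip: galois)
  ultimately show ?thesis
    unfolding adjoint_maps_def monotone_map_def isotone_def using P Q l r galois by auto
qed

text \<open>
  Every function gives an element of a fibre once its values outside the index set are forgotten, so
  deductions can use arbitrary functions.
\<close>

definition element :: "(('u \<Rightarrow> 'a) \<Rightarrow> 'p) \<Rightarrow> 'u set \<Rightarrow> ('u \<Rightarrow> 'a) \<Rightarrow> 'p" where
  "element e X \<phi> = e (restrict \<phi> X)"

text \<open>
  The Kleisli preorders of \<open>j\<close>: a family \<open>\<phi>\<close> is below \<open>\<psi>\<close> if \<open>\<phi>\<close> entails \<open>j \<circ> \<psi>\<close>. Up to
  equivalence these are the families closed under \<open>j\<close>. The injection \<open>e\<close> places the elements in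
  an arbitrary type. The arrow tripos is the case where \<open>j\<close> and \<open>e\<close> are identities, so one
  proof of the tripos axioms serves both for the arrow tripos and for all its subtriposes.
\<close>

definition closed_tripos ::
  "'a::complete_lattice arrow_structure \<Rightarrow> ('a \<Rightarrow> 'a) \<Rightarrow> (('u \<Rightarrow> 'a) \<Rightarrow> 'p) \<Rightarrow> ('u, 'p) indexed_preorder"
  where
  "closed_tripos A j e =
     \<lparr>fibre = (\<lambda>X. preorder_of (e ` (X \<rightarrow>\<^sub>E UNIV)) (\<lambda>x y. entails A X (inv e x) (j \<circ> inv e y))),
      reindex = (\<lambda>X Y f x. element e X (inv e x \<circ> f))\<rparr>"

lemma arrow_tripos_eq_closed_tripos: "arrow_tripos A = closed_tripos A id id"
  by (simp add: arrow_tripos_def closed_tripos_def element_def compose_def restrict_def fun_eq_iff)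

context nucleus_logic
begin

lemma closed_refl: "proves A I [p] (\<lambda>i. j (p i))"
  by (simp add: proves_unit proves_hyp)

lemma closed_cut: "proves A I G (\<lambda>i. j (p i)) \<Longrightarrow> proves A I [p] (\<lambda>i. j (q i)) \<Longrightarrow> proves A I G (\<lambda>i. j (q i))"
  by (rule proves_bind) (auto elim: proves_weaken)

lemma closed_meet_iff:
  "proves A I [r] (\<lambda>i. j (p i \<^bold>\<and> q i)) \<longleftrightarrow> proves A I [r] (\<lambda>i. j (p i)) \<and> proves A I [r] (\<lambda>i. j (q i))"
proof safe
  assume pq: "proves A I [r] (\<lambda>i. j (p i \<^bold>\<and> q i))"
  show "proves A I [r] (\<lambda>i. j (p i))" "proves A I [r] (\<lambda>i. j (q i))"
    by (rule closed_cut[OF pq], rule proves_unit, rule proves_conjE[OF proves_hyp],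
        auto intro: proves_hyp)+
next
  assume p: "proves A I [r] (\<lambda>i. j (p i))" and q: "proves A I [r] (\<lambda>i. j (q i))"
  show "proves A I [r] (\<lambda>i. j (p i \<^bold>\<and> q i))"
    by (rule proves_bind[OF p], rule proves_bind[OF proves_weaken1[OF q]], rule proves_unit,
        rule proves_conjI; simp add: proves_hyp)
qed

lemma closed_join_iff:
  "proves A I [\<lambda>i. p i \<^bold>\<or> q i] (\<lambda>i. j (r i)) \<longleftrightarrow> proves A I [p] (\<lambda>i. j (r i)) \<and> proves A I [q] (\<lambda>i. j (r i))"
proof safe
  assume pq: "proves A I [\<lambda>i. p i \<^bold>\<or> q i] (\<lambda>i. j (r i))"
  have "proves A I [p] (\<lambda>i. p i \<^bold>\<or> q i)" "proves A I [q] (\<lambda>i. p i \<^bold>\<or> q i)"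
    by (rule proves_disjI1, simp add: proves_hyp) (rule proves_disjI2, simp add: proves_hyp)
  then show "proves A I [p] (\<lambda>i. j (r i))" "proves A I [q] (\<lambda>i. j (r i))"
    by (auto intro: closed_cut[OF proves_unit pq])
next
  assume "proves A I [p] (\<lambda>i. j (r i))" "proves A I [q] (\<lambda>i. j (r i))"
  then show "proves A I [\<lambda>i. p i \<^bold>\<or> q i] (\<lambda>i. j (r i))"
    by - (rule proves_disjE[OF proves_hyp], auto elim: proves_weaken)
qed

text \<open>
  Implication in the Kleisli preorder is \<open>p \<leadsto> j q\<close>. The outer \<open>j\<close> is harmless: as the conclusion
  \<open>j q\<close> is already under \<open>j\<close>, bind removes it.
\<close>

lemma closed_imp_iff:
  "proves A I [r] (\<lambda>i. j (p i \<leadsto> j (q i))) \<longleftrightarrow> proves A I [\<lambda>i. r i \<^bold>\<and> p i] (\<lambda>i. j (q i))"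
proof
  assume h: "proves A I [r] (\<lambda>i. j (p i \<leadsto> j (q i)))"
  let ?G = "[p, r, \<lambda>i. r i \<^bold>\<and> p i]"
  have "proves A I ?G (\<lambda>i. j (q i))"
  proof (rule proves_bind)
    show "proves A I ?G (\<lambda>i. j (p i \<leadsto> j (q i)))" using h by (rule proves_weaken) simp
    show "proves A I ((\<lambda>i. p i \<leadsto> j (q i)) # ?G) (\<lambda>i. j (q i))"
      by (rule proves_mp[of _ _ p]) (simp_all add: proves_hyp)
  qed
  then show "proves A I [\<lambda>i. r i \<^bold>\<and> p i] (\<lambda>i. j (q i))"
    by (rule proves_conjE[OF proves_hyp, rotated]) simp
next
  assume h: "proves A I [\<lambda>i. r i \<^bold>\<and> p i] (\<lambda>i. j (q i))"
  have "proves A I [p, r] (\<lambda>i. j (q i))"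
    by (rule closed_cut[OF proves_unit h]) (simp add: proves_conjI proves_hyp)
  then show "proves A I [r] (\<lambda>i. j (p i \<leadsto> j (q i)))"
    by (intro proves_unit) (simp add: proves_Cons)
qed

text \<open>
  The left adjoint is that of the logic itself, since the order applies \<open>j\<close> only on the right.
\<close>

lemma closed_exists_iff:
  assumes f: "f \<in> I \<rightarrow> K"
  shows "proves A K [\<lambda>k. exists {i \<in> I. f i = k} p] (\<lambda>k. j (q k)) \<longleftrightarrow> proves A I [p] (\<lambda>i. j (q (f i)))"
proof
  assume "proves A K [\<lambda>k. exists {i \<in> I. f i = k} p] (\<lambda>k. j (q k))"
  from proves_reindex[OF this, of I f] f
  have h: "proves A I [\<lambda>i'. exists {i \<in> I. f i = f i'} p] (\<lambda>i. j (q (f i)))" by auto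
  show "proves A I [p] (\<lambda>i. j (q (f i)))"
    by (rule closed_cut[OF proves_unit h], rule proves_existsI[where f = "\<lambda>i. i"])
      (auto simp: proves_hyp)
next
  assume h: "proves A I [p] (\<lambda>i. j (q (f i)))"
  show "proves A K [\<lambda>k. exists {i \<in> I. f i = k} p] (\<lambda>k. j (q k))"
  proof (rule proves_existsE[OF proves_hyp])
    let ?K = "SIGMA k:K. {i \<in> I. f i = k}" and ?G = "[\<lambda>k. exists {i \<in> I. f i = k} p]"
    have "proves A ?K [\<lambda>x. p (snd x)] (\<lambda>x. j (q (f (snd x))))"
      using proves_reindex[OF h, of ?K snd] by auto
    then have "proves A ?K ((\<lambda>x. p (snd x)) # map (\<lambda>g x. g (fst x)) ?G) (\<lambda>x. j (q (f (snd x))))"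
      by (rule proves_weaken) simp
    then show "proves A ?K ((\<lambda>x. p (snd x)) # map (\<lambda>g x. g (fst x)) ?G) (\<lambda>x. j (q (fst x)))"
      by (rule iffD1[OF proves_cong, rotated 2]) auto
  qed simp
qed

text \<open>
  The right adjoint has to quantify over \<open>j (p i)\<close>: a nucleus need not commute with universal
  quantification.
\<close>

lemma closed_forall_iff:
  assumes f: "f \<in> I \<rightarrow> K"
  shows "proves A K [q] (\<lambda>k. j (forall {i \<in> I. f i = k} (\<lambda>i. j (p i)))) \<longleftrightarrow>
    proves A I [\<lambda>i. q (f i)] (\<lambda>i. j (p i))"
proof
  assume "proves A K [q] (\<lambda>k. j (forall {i \<in> I. f i = k} (\<lambda>i. j (p i))))"
  from proves_reindex[OF this, of I f] f
  have h: "proves A I [\<lambda>i. q (f i)] (\<lambda>i'. j (forall {i \<in> I. f i = f i'} (\<lambda>i. j (p i))))" by auto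
  show "proves A I [\<lambda>i. q (f i)] (\<lambda>i. j (p i))"
    by (rule closed_cut[OF h],
        rule proves_forallD[where f = "\<lambda>i. i" and J = "\<lambda>k. {i \<in> I. f i = f k}", OF proves_hyp])
      auto
next
  assume h: "proves A I [\<lambda>i. q (f i)] (\<lambda>i. j (p i))"
  show "proves A K [q] (\<lambda>k. j (forall {i \<in> I. f i = k} (\<lambda>i. j (p i))))"
  proof (rule proves_unit, rule proves_forallI)
    let ?K = "SIGMA k:K. {i \<in> I. f i = k}"
    have "proves A ?K [\<lambda>x. q (f (snd x))] (\<lambda>x. j (p (snd x)))"
      using proves_reindex[OF h, of ?K snd] by auto
    then show "proves A ?K (map (\<lambda>g x. g (fst x)) [q]) (\<lambda>x. j (p (snd x)))"
      by (rule iffD1[OF proves_cong, rotated 2]) auto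
  qed
qed

end

locale coded_nucleus_logic = nucleus_logic A j for A :: "'a::complete_lattice arrow_structure" (structure) and j +
  fixes e :: "('u \<Rightarrow> 'a) \<Rightarrow> 'p"
  assumes inj_e: "inj e"
begin

abbreviation Q :: "('u, 'p) indexed_preorder" where "Q \<equiv> closed_tripos A j e"

lemma inv_element: "inv e (element e X \<phi>) = restrict \<phi> X"
  by (simp add: element_def inj_e)

lemma element_cong: "(\<And>i. i \<in> X \<Longrightarrow> \<phi> i = \<psi> i) \<Longrightarrow> element e X \<phi> = element e X \<psi>"
  by (simp add: element_def restrict_def cong: if_cong)

lemma fibre_carrier: "carrier (fibre Q X) = range (element e X)"
proof -
  have "X \<rightarrow>\<^sub>E (UNIV :: 'a set) = range (\<lambda>\<phi>. restrict \<phi> X)"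
    by (auto simp: image_iff intro!: exI[where x = \<phi> for \<phi>] dest: PiE_restrict[symmetric])
  then show ?thesis by (simp add: closed_tripos_def element_def image_image)
qed

lemma fibre_le:
  "element e X \<phi> \<sqsubseteq>\<^bsub>fibre Q X\<^esub> element e X \<psi> \<longleftrightarrow> proves A X [\<phi>] (\<lambda>i. j (\<psi> i))"
  by (auto simp: closed_tripos_def inv_element entails_iff_proves intro!: proves_cong)

lemma fibre_eq:
  "x .=\<^bsub>fibre Q X\<^esub> y \<longleftrightarrow> x \<sqsubseteq>\<^bsub>fibre Q X\<^esub> y \<and> y \<sqsubseteq>\<^bsub>fibre Q X\<^esub> x"
  by (simp add: closed_tripos_def)

lemma reindex_element:
  "f \<in> X \<rightarrow> Y \<Longrightarrow> reindex Q X Y f (element e Y \<phi>) = element e X (\<lambda>i. \<phi> (f i))"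
  by (auto simp: closed_tripos_def inv_element intro!: element_cong)

lemma weak_partial_order_fibre: "weak_partial_order (fibre Q X)"
proof -
  have "weak_partial_order (preorder_of (carrier (fibre Q X)) (\<sqsubseteq>\<^bsub>fibre Q X\<^esub>))"
    by (rule weak_partial_order_preorder_of)
      (auto simp: fibre_carrier fibre_le closed_refl elim: closed_cut)
  then show ?thesis by (simp add: closed_tripos_def preorder_of_def)
qed

definition lift2 :: "('a \<Rightarrow> 'a \<Rightarrow> 'a) \<Rightarrow> 'u set \<Rightarrow> 'p \<Rightarrow> 'p \<Rightarrow> 'p" where
  "lift2 h X x y = element e X (\<lambda>i. h (inv e x i) (inv e y i))"

lemma lift2_element:
  "lift2 h X (element e X \<phi>) (element e X \<psi>) = element e X (\<lambda>i. h (\<phi> i) (\<psi> i))"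
  by (auto simp: lift2_def inv_element intro!: element_cong)

lemma heyting_operations_fibre:
  "heyting_operations (fibre Q X) (element e X (\<lambda>_. true)) (element e X (\<lambda>_. bot))
     (lift2 (\<^bold>\<and>) X) (lift2 (\<^bold>\<or>) X) (lift2 (\<lambda>a b. a \<leadsto> j b) X)"
  by (intro heyting_operations.intro weak_partial_order_fibre heyting_operations_axioms.intro)
    (auto simp: fibre_carrier lift2_element fibre_le closed_meet_iff closed_join_iff closed_imp_iff
      proves_unit[OF proves_true] proves_falsum[OF proves_hyp])

definition ex_along :: "'u set \<Rightarrow> 'u set \<Rightarrow> ('u \<Rightarrow> 'u) \<Rightarrow> 'p \<Rightarrow> 'p" where
  "ex_along X Y f x = element e Y (\<lambda>y. exists {i \<in> X. f i = y} (inv e x))"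

definition all_along :: "'u set \<Rightarrow> 'u set \<Rightarrow> ('u \<Rightarrow> 'u) \<Rightarrow> 'p \<Rightarrow> 'p" where
  "all_along X Y f x = element e Y (\<lambda>y. forall {i \<in> X. f i = y} (\<lambda>i. j (inv e x i)))"

lemma ex_along_element:
  "ex_along X Y f (element e X \<phi>) = element e Y (\<lambda>y. exists {i \<in> X. f i = y} \<phi>)"
  by (auto simp: ex_along_def inv_element exists_def intro!: element_cong INF_cong arg_cong2[where f = "(\<leadsto>)"])

lemma all_along_element:
  "all_along X Y f (element e X \<phi>) = element e Y (\<lambda>y. forall {i \<in> X. f i = y} (\<lambda>i. j (\<phi> i)))"
  by (auto simp: all_along_def inv_element forall_def intro!: element_cong INF_cong)

lemma adjoint_along:
  assumes "f \<in> X \<rightarrow> Y"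
  shows "adjoint_maps (fibre Q X) (fibre Q Y) (ex_along X Y f) (reindex Q X Y f)"
    and "adjoint_maps (fibre Q Y) (fibre Q X) (reindex Q X Y f) (all_along X Y f)"
  using assms
  by (auto intro!: adjoint_mapsI weak_partial_order_fibre
      simp: fibre_carrier reindex_element ex_along_element all_along_element fibre_le
        closed_exists_iff closed_forall_iff)

lemma heyting_prealgebra_map_reindex:
  assumes f: "f \<in> X \<rightarrow> Y"
  shows "heyting_prealgebra_map (fibre Q Y) (fibre Q X) (reindex Q X Y f)"
  by (rule heyting_prealgebra_mapI[OF heyting_operations_fibre heyting_operations_fibre])
    (use adjoint_along(1)[OF f] f in
      \<open>auto simp: adjoint_maps_def fibre_carrier reindex_element lift2_element\<close>)

text \<open>
  Beck-Chevalley holds on the nose: the quantifiers on both sides range over the same set of values.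
\<close>

lemma pullback_fibre:
  assumes "pullback_square W X Y Z p q f g" "y \<in> Y"
  shows "{x \<in> X. f x = g y} = p ` {w \<in> W. q w = y}"
proof -
  have "(\<lambda>w. (p w, q w)) ` W = {(x, y) \<in> X \<times> Y. f x = g y}"
    using assms(1) by (simp add: pullback_square_def bij_betw_def)
  then show ?thesis using assms(2) by (auto simp: set_eq_iff image_iff) metis+
qed

lemma has_quantifiers: "has_quantifiers U Q"
  unfolding has_quantifiers_def
proof (rule exI[where x = ex_along], rule exI[where x = all_along], intro conjI ballI allI impI)
  fix X Y and f :: "'u \<Rightarrow> 'u" assume "f \<in> X \<rightarrow>\<^sub>E Y"
  then have "f \<in> X \<rightarrow> Y" by auto
  then show "adjoint_maps (fibre Q X) (fibre Q Y) (ex_along X Y f) (reindex Q X Y f)"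
    "adjoint_maps (fibre Q Y) (fibre Q X) (reindex Q X Y f) (all_along X Y f)"
    by (rule adjoint_along)+
next
  fix W X Y Z and p q f g :: "'u \<Rightarrow> 'u" and x
  assume sq: "pullback_square W X Y Z p q f g" and "x \<in> carrier (fibre Q X)"
  then obtain \<phi> where x: "x = element e X \<phi>" by (auto simp: fibre_carrier)
  have maps: "p \<in> W \<rightarrow> X" "q \<in> W \<rightarrow> Y" "f \<in> X \<rightarrow> Z" "g \<in> Y \<rightarrow> Z"
    using sq by (auto simp: pullback_square_def)
  have refl: "element e Y \<psi> .=\<^bsub>fibre Q Y\<^esub> element e Y \<psi>" for \<psi>
    by (simp add: fibre_eq fibre_le closed_refl)
  show "reindex Q Y Z g (ex_along X Z f x) .=\<^bsub>fibre Q Y\<^esub> ex_along W Y q (reindex Q W X p x)"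
    "reindex Q Y Z g (all_along X Z f x) .=\<^bsub>fibre Q Y\<^esub> all_along W Y q (reindex Q W X p x)"
    unfolding x using maps refl
    by (auto simp: reindex_element ex_along_element all_along_element exists_def forall_def
        pullback_fibre[OF sq] image_image cong: element_cong)
qed

lemma heyting_pseudofunctor: "heyting_pseudofunctor U Q"
  unfolding heyting_pseudofunctor_def
proof (intro conjI ballI)
  fix X
  show "heyting_prealgebra (fibre Q X)"
    using heyting_operations.heyting_prealgebra[OF heyting_operations_fibre] .
next
  fix X Y and f :: "'u \<Rightarrow> 'u" assume "f \<in> X \<rightarrow>\<^sub>E Y"
  then show "heyting_prealgebra_map (fibre Q Y) (fibre Q X) (reindex Q X Y f)"
    by (intro heyting_prealgebra_map_reindex) auto
next
  fix X x assume "x \<in> carrier (fibre Q X)"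
  then show "reindex Q X X (\<lambda>x\<in>X. x) x .=\<^bsub>fibre Q X\<^esub> x"
    by (auto simp: fibre_carrier reindex_element fibre_eq fibre_le closed_refl cong: element_cong)
next
  fix X Y Z and f g :: "'u \<Rightarrow> 'u" and x
  assume "f \<in> X \<rightarrow>\<^sub>E Y" "g \<in> Y \<rightarrow>\<^sub>E Z" "x \<in> carrier (fibre Q Z)"
  then show "reindex Q X Z (compose X g f) x .=\<^bsub>fibre Q X\<^esub> reindex Q X Y f (reindex Q Y Z g x)"
    by (auto simp: fibre_carrier reindex_element fibre_eq fibre_le closed_refl compose_def
        Pi_iff PiE_iff cong: element_cong)
qed

lemma has_generic_element:
  fixes code :: "'a \<Rightarrow> 'u"
  assumes "inj code" "range code \<in> U"
  shows "has_generic_element U Q"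
  unfolding has_generic_element_def
proof (rule bexI[OF _ assms(2)], rule bexI[where x = "element e (range code) (inv code)"], intro ballI)
  show "element e (range code) (inv code) \<in> carrier (fibre Q (range code))"
    by (simp add: fibre_carrier)
  fix X x assume "x \<in> carrier (fibre Q X)"
  then obtain \<phi> where x: "x = element e X \<phi>" by (auto simp: fibre_carrier)
  have "x .=\<^bsub>fibre Q X\<^esub> reindex Q X (range code) (restrict (code \<circ> \<phi>) X) (element e (range code) (inv code))"
    unfolding x by (subst reindex_element)
      (auto simp: assms(1) fibre_eq fibre_le closed_refl cong: element_cong)
  then show "\<exists>g\<in>X \<rightarrow>\<^sub>E range code. x .=\<^bsub>fibre Q X\<^esub> reindex Q X (range code) g (element e (range code) (inv code))"
    by (rule bexI[where x = "restrict (code \<circ> \<phi>) X"]) auto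
qed

lemma tripos_closed_tripos:
  fixes code :: "'a \<Rightarrow> 'u"
  assumes "inj code" "range code \<in> U"
  shows "tripos U Q"
  unfolding tripos_def
  using heyting_pseudofunctor has_quantifiers has_generic_element[OF assms] by blast

end

lemma (in arrow_logic) tripos_arrow_tripos:
  fixes code :: "'a \<Rightarrow> 'u"
  assumes "inj code" "range code \<in> U"
  shows "tripos U (arrow_tripos A)"
proof -
  interpret coded_nucleus_logic A id "id :: ('u \<Rightarrow> 'a) \<Rightarrow> 'u \<Rightarrow> 'a"
    by unfold_locales (simp_all add: nucleus_id)
  show ?thesis unfolding arrow_tripos_eq_closed_tripos by (rule tripos_closed_tripos[OF assms])
qed

section \<open>Subtriposes and closure transformations\<close>

lemma monotone_mapD:
  assumes "monotone_map P Q f"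
  shows "x \<in> carrier P \<Longrightarrow> f x \<in> carrier Q"
    and "x \<in> carrier P \<Longrightarrow> y \<in> carrier P \<Longrightarrow> x \<sqsubseteq>\<^bsub>P\<^esub> y \<Longrightarrow> f x \<sqsubseteq>\<^bsub>Q\<^esub> f y"
    and "x \<in> carrier P \<Longrightarrow> y \<in> carrier P \<Longrightarrow> x .=\<^bsub>P\<^esub> y \<Longrightarrow> f x .=\<^bsub>Q\<^esub> f y"
    and "weak_partial_order P" "weak_partial_order Q"
  using assms weak_partial_order.eq_iff_le_le[of P x y] weak_partial_order.eq_iff_le_le[of Q "f x" "f y"]
  unfolding monotone_map_def isotone_def by auto

lemma monotone_map_comp:
  assumes f: "monotone_map P Q f" and g: "monotone_map Q R g"
  shows "monotone_map P R (\<lambda>x. g (f x))"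
  using monotone_mapD[OF f] monotone_mapD[OF g]
  unfolding monotone_map_def[of P R] isotone_def by auto

lemma preserves_finite_meets_comp:
  assumes f: "monotone_map P Q f"
    and "preserves_finite_meets P Q f" "preserves_finite_meets Q R g"
  shows "preserves_finite_meets P R (\<lambda>x. g (f x))"
  unfolding preserves_finite_meets_def
proof (intro allI impI, elim conjE)
  fix F m assume F: "finite F" "F \<subseteq> carrier P" "greatest P m (Lower P F)"
  then have "greatest Q (f m) (Lower Q (f ` F))"
    using assms(2) by (simp add: preserves_finite_meets_def)
  moreover have "finite (f ` F)" "f ` F \<subseteq> carrier Q"
    using F monotone_mapD(1)[OF f] by auto
  ultimately have "greatest R (g (f m)) (Lower R (g ` f ` F))"
    using assms(3) unfolding preserves_finite_meets_def by blast
  then show "greatest R (g (f m)) (Lower R ((\<lambda>x. g (f x)) ` F))"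
    by (simp add: image_image)
qed

text \<open>
  This makes direct images cartesian, and hence all composites of inverse and direct images.
\<close>

lemma right_adjoint_preserves_finite_meets:
  assumes "adjoint_maps P Q l r"
  shows "preserves_finite_meets Q P r"
  unfolding preserves_finite_meets_def
proof (intro allI impI, elim conjE)
  fix F m assume F: "finite F" "F \<subseteq> carrier Q" and m: "greatest Q m (Lower Q F)"
  have l: "monotone_map P Q l" and r: "monotone_map Q P r"
    and galois: "\<And>x y. x \<in> carrier P \<Longrightarrow> y \<in> carrier Q \<Longrightarrow> l x \<sqsubseteq>\<^bsub>Q\<^esub> y \<longleftrightarrow> x \<sqsubseteq>\<^bsub>P\<^esub> r y"
    using assms by (auto simp: adjoint_maps_def)
  have m': "m \<in> carrier Q" "\<And>x. x \<in> F \<Longrightarrow> m \<sqsubseteq>\<^bsub>Q\<^esub> x"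
    "\<And>z. z \<in> carrier Q \<Longrightarrow> (\<And>x. x \<in> F \<Longrightarrow> z \<sqsubseteq>\<^bsub>Q\<^esub> x) \<Longrightarrow> z \<sqsubseteq>\<^bsub>Q\<^esub> m"
    using m by (auto simp: greatest_Lower_iff[OF F(2)])
  have rF: "r ` F \<subseteq> carrier P" using F monotone_mapD(1)[OF r] by auto
  show "greatest P (r m) (Lower P (r ` F))"
    unfolding greatest_Lower_iff[OF rF]
  proof (intro conjI ballI impI)
    fix z assume z: "z \<in> carrier P" "\<forall>x\<in>r ` F. z \<sqsubseteq>\<^bsub>P\<^esub> x"
    then have "l z \<sqsubseteq>\<^bsub>Q\<^esub> x" if "x \<in> F" for x using that F galois by auto
    then have "l z \<sqsubseteq>\<^bsub>Q\<^esub> m" by (rule m'(3)[OF monotone_mapD(1)[OF l z(1)]])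
    then show "z \<sqsubseteq>\<^bsub>P\<^esub> r m" using galois[OF z(1) m'(1)] by simp
  qed (use m' F monotone_mapD[OF r] in auto)
qed

lemma heyting_pseudofunctorD:
  assumes "heyting_pseudofunctor U P"
  shows "X \<in> U \<Longrightarrow> weak_partial_order (fibre P X)"
    and "X \<in> U \<Longrightarrow> Y \<in> U \<Longrightarrow> f \<in> X \<rightarrow>\<^sub>E Y \<Longrightarrow> monotone_map (fibre P Y) (fibre P X) (reindex P X Y f)"
  using assms unfolding heyting_pseudofunctor_def heyting_prealgebra_def heyting_prealgebra_map_def
  by auto

lemma is_transformation_comp:
  assumes P: "heyting_pseudofunctor U P" and Q: "heyting_pseudofunctor U Q" and R: "heyting_pseudofunctor U R"
    and \<Phi>: "is_transformation U P Q \<Phi>" and \<Psi>: "is_transformation U Q R \<Psi>"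
  shows "is_transformation U P R (trans_comp \<Psi> \<Phi>)"
  unfolding is_transformation_def trans_comp_def
proof (intro conjI ballI)
  fix X assume X: "X \<in> U"
  have mono: "monotone_map (fibre P X) (fibre Q X) (\<Phi> X)" "monotone_map (fibre Q X) (fibre R X) (\<Psi> X)"
    if "X \<in> U" for X
    using \<Phi> \<Psi> that by (auto simp: is_transformation_def)
  then show "monotone_map (fibre P X) (fibre R X) (\<lambda>x. \<Psi> X (\<Phi> X x))"
    using X monotone_map_comp by blast
  fix Y f x assume Y: "Y \<in> U" and f: "f \<in> X \<rightarrow>\<^sub>E Y" and x: "x \<in> carrier (fibre P Y)"
  interpret R: weak_partial_order "fibre R X" by (rule heyting_pseudofunctorD(1)[OF R X])
  note Pf = monotone_mapD(1)[OF heyting_pseudofunctorD(2)[OF P X Y f]]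
    and Qf = monotone_mapD(1)[OF heyting_pseudofunctorD(2)[OF Q X Y f]]
    and Rf = monotone_mapD(1)[OF heyting_pseudofunctorD(2)[OF R X Y f]]
    and \<Phi>X = monotone_mapD(1)[OF mono(1)[OF X]] and \<Psi>X = monotone_mapD(1)[OF mono(2)[OF X]]
    and \<Phi>Y = monotone_mapD(1)[OF mono(1)[OF Y]] and \<Psi>Y = monotone_mapD(1)[OF mono(2)[OF Y]]
  have "\<Phi> X (reindex P X Y f x) .=\<^bsub>fibre Q X\<^esub> reindex Q X Y f (\<Phi> Y x)"
    using \<Phi> X Y f x unfolding is_transformation_def by blast
  then have "\<Psi> X (\<Phi> X (reindex P X Y f x)) .=\<^bsub>fibre R X\<^esub> \<Psi> X (reindex Q X Y f (\<Phi> Y x))"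
    by (rule monotone_mapD(3)[OF mono(2)[OF X] \<Phi>X[OF Pf[OF x]] Qf[OF \<Phi>Y[OF x]]])
  moreover have "\<Psi> X (reindex Q X Y f (\<Phi> Y x)) .=\<^bsub>fibre R X\<^esub> reindex R X Y f (\<Psi> Y (\<Phi> Y x))"
    using \<Psi> X Y f \<Phi>Y[OF x] unfolding is_transformation_def by blast
  ultimately show "\<Psi> X (\<Phi> X (reindex P X Y f x)) .=\<^bsub>fibre R X\<^esub> reindex R X Y f (\<Psi> Y (\<Phi> Y x))"
    by (rule R.trans) (intro \<Psi>X \<Phi>X Pf Qf Rf \<Psi>Y \<Phi>Y x)+
qed

lemma cartesian_transformation_comp:
  assumes P: "heyting_pseudofunctor U P" and Q: "heyting_pseudofunctor U Q" and R: "heyting_pseudofunctor U R"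
    and \<Phi>: "cartesian_transformation U P Q \<Phi>" and \<Psi>: "cartesian_transformation U Q R \<Psi>"
  shows "cartesian_transformation U P R (trans_comp \<Psi> \<Phi>)"
proof -
  have "preserves_finite_meets (fibre P X) (fibre R X) (\<lambda>x. \<Psi> X (\<Phi> X x))" if "X \<in> U" for X
    using \<Phi> \<Psi> that unfolding cartesian_transformation_def is_transformation_def
    by (intro preserves_finite_meets_comp[where Q = "fibre Q X" and f = "\<Phi> X" and g = "\<Psi> X"]) simp_all
  then show ?thesis
    using is_transformation_comp[OF P Q R] \<Phi> \<Psi>
    by (simp add: cartesian_transformation_def trans_comp_def[abs_def])
qed

lemma weak_partial_order_ClTrans:
  assumes P: "heyting_pseudofunctor U P"
  shows "weak_partial_order (ClTrans U P)"
  unfolding ClTrans_def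
proof (rule weak_partial_order_preorder_of; clarify)
  fix \<Phi> assume "closure_transformation U P \<Phi>"
  then have "monotone_map (fibre P X) (fibre P X) (\<Phi> X)" if "X \<in> U" for X
    using that by (simp add: closure_transformation_def cartesian_transformation_def is_transformation_def)
  note closed = monotone_mapD(1)[OF this]
  show "trans_le U P P \<Phi> \<Phi>"
    unfolding trans_le_def
    by (auto intro!: weak_partial_order.le_refl heyting_pseudofunctorD(1)[OF P] closed)
next
  fix \<Phi> \<Psi> \<Omega>
  assume cl: "closure_transformation U P \<Phi>" "closure_transformation U P \<Psi>" "closure_transformation U P \<Omega>"
    and le: "trans_le U P P \<Phi> \<Psi>" "trans_le U P P \<Psi> \<Omega>"
  have "\<Xi> X x \<in> carrier (fibre P X)"
    if "closure_transformation U P \<Xi>" "X \<in> U" "x \<in> carrier (fibre P X)" for \<Xi> X x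
    using that monotone_mapD(1)[of "fibre P X" "fibre P X" "\<Xi> X"]
    by (simp add: closure_transformation_def cartesian_transformation_def is_transformation_def)
  with cl le show "trans_le U P P \<Phi> \<Omega>"
    unfolding trans_le_def
    by (meson weak_partial_order.le_trans[OF heyting_pseudofunctorD(1)[OF P]])
qed

definition closure_of_inclusion :: "('u, 'q, 'p) geometric \<Rightarrow> ('u, 'p, 'p) transformation" where
  "closure_of_inclusion \<Phi> = trans_comp (snd \<Phi>) (fst \<Phi>)"

locale inclusion =
  fixes U :: "'u set set" and Q :: "('u, 'q) indexed_preorder" and P :: "('u, 'p) indexed_preorder"
    and \<Phi> :: "('u, 'q, 'p) geometric"
  assumes inclusion: "geometric_inclusion U Q P \<Phi>"
begin

abbreviation inverse where "inverse \<equiv> fst \<Phi>"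
abbreviation direct where "direct \<equiv> snd \<Phi>"

lemma morphism: "geometric_morphism U Q P \<Phi>"
  using inclusion by (simp add: geometric_inclusion_def)

lemma triposes: "tripos U Q" "tripos U P"
  using morphism by (simp_all add: geometric_morphism_def)

lemma pseudofunctors: "heyting_pseudofunctor U Q" "heyting_pseudofunctor U P"
  using triposes by (simp_all add: tripos_def)

lemma adjoint: "X \<in> U \<Longrightarrow> adjoint_maps (fibre P X) (fibre Q X) (inverse X) (direct X)"
  using morphism by (simp add: geometric_morphism_def)

lemma galois: "\<lbrakk>X \<in> U; x \<in> carrier (fibre P X); y \<in> carrier (fibre Q X)\<rbrakk> \<Longrightarrow>
    inverse X x \<sqsubseteq>\<^bsub>fibre Q X\<^esub> y \<longleftrightarrow> x \<sqsubseteq>\<^bsub>fibre P X\<^esub> direct X y"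
  using adjoint by (simp add: adjoint_maps_def)

lemma monotone:
  assumes "X \<in> U"
  shows "monotone_map (fibre P X) (fibre Q X) (inverse X)" "monotone_map (fibre Q X) (fibre P X) (direct X)"
  using adjoint[OF assms] by (simp_all add: adjoint_maps_def)

lemmas inverse_closed = monotone_mapD(1)[OF monotone(1)]
lemmas direct_closed = monotone_mapD(1)[OF monotone(2)]
lemmas inverse_mono = monotone_mapD(2)[OF monotone(1)]
lemmas direct_mono = monotone_mapD(2)[OF monotone(2)]
lemmas Q_refl = weak_partial_order.le_refl[OF heyting_pseudofunctorD(1)[OF pseudofunctors(1)]]
lemmas Q_trans = weak_partial_order.le_trans[OF heyting_pseudofunctorD(1)[OF pseudofunctors(1)]]
lemmas P_refl = weak_partial_order.le_refl[OF heyting_pseudofunctorD(1)[OF pseudofunctors(2)]]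
lemmas P_trans = weak_partial_order.le_trans[OF heyting_pseudofunctorD(1)[OF pseudofunctors(2)]]

lemma cartesian: "cartesian_transformation U P Q inverse" "cartesian_transformation U Q P direct"
  using morphism adjoint
  by (auto simp: geometric_morphism_def cartesian_transformation_def
      intro: right_adjoint_preserves_finite_meets)

lemma unit: "\<lbrakk>X \<in> U; x \<in> carrier (fibre P X)\<rbrakk> \<Longrightarrow> x \<sqsubseteq>\<^bsub>fibre P X\<^esub> direct X (inverse X x)"
  by (simp add: inverse_closed Q_refl flip: galois)

lemma counit: "\<lbrakk>X \<in> U; y \<in> carrier (fibre Q X)\<rbrakk> \<Longrightarrow> inverse X (direct X y) \<sqsubseteq>\<^bsub>fibre Q X\<^esub> y"
  by (simp add: direct_closed P_refl galois)

lemma counit_inverse: "\<lbrakk>X \<in> U; y \<in> carrier (fibre Q X)\<rbrakk> \<Longrightarrow> y \<sqsubseteq>\<^bsub>fibre Q X\<^esub> inverse X (direct X y)"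
  using inclusion
  by (auto simp: geometric_inclusion_def trans_iso_def trans_le_def trans_comp_def trans_id_def)

text \<open>
  The monad of the adjunction. It is idempotent because the counit is an isomorphism.
\<close>

lemma closure_transformation: "closure_transformation U P (closure_of_inclusion \<Phi>)"
  unfolding closure_transformation_def
proof (intro conjI)
  show "cartesian_transformation U P P (closure_of_inclusion \<Phi>)"
    unfolding closure_of_inclusion_def
    using cartesian_transformation_comp pseudofunctors cartesian by blast
  show "trans_le U P P trans_id (closure_of_inclusion \<Phi>)"
    by (auto simp: trans_le_def trans_id_def trans_comp_def closure_of_inclusion_def unit)
  have "direct X (inverse X (direct X (inverse X x))) \<sqsubseteq>\<^bsub>fibre P X\<^esub> direct X (inverse X x)"
    if "X \<in> U" "x \<in> carrier (fibre P X)" for X x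
    using that by (intro direct_mono counit) (auto intro: inverse_closed direct_closed)
  then show "trans_iso U P P (trans_comp (closure_of_inclusion \<Phi>) (closure_of_inclusion \<Phi>)) (closure_of_inclusion \<Phi>)"
    by (auto simp: trans_iso_def trans_le_def trans_comp_def closure_of_inclusion_def
        intro!: unit inverse_closed direct_closed)
qed

end

text \<open>
  Subtriposes are ordered opposite to their closure transformations. If \<open>\<Phi>\<close> factors through \<open>\<Psi>\<close> via
  \<open>\<Theta>\<close>, then the closure of \<open>x\<close> under \<open>\<Phi>\<close> lies in the image of \<open>\<Psi>\<^sub>+\<close>, and the closure of \<open>x\<close>
  under \<open>\<Psi>\<close> is the least element of that image above \<open>x\<close>. Conversely the factor is
  \<open>(\<Phi>\<^sup>+ \<Psi>\<^sub>+, \<Psi>\<^sup>+ \<Phi>\<^sub>+)\<close>; the comparison of closures says that \<open>\<Psi>\<close>-closing does not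
  move the elements in the image of \<open>\<Phi>\<^sub>+\<close>, which gives both the adjunction and the factorization.
\<close>

lemma subtripos_le_iff_closure_ge:
  assumes "geometric_inclusion U Q P \<Phi>" "geometric_inclusion U R P \<Psi>"
  shows "(\<exists>\<Theta>. geometric_morphism U Q R \<Theta> \<and> trans_iso U Q P (snd \<Phi>) (trans_comp (snd \<Psi>) (snd \<Theta>))) \<longleftrightarrow>
    trans_le U P P (closure_of_inclusion \<Psi>) (closure_of_inclusion \<Phi>)" (is "?L \<longleftrightarrow> ?R")
proof
  interpret F: inclusion U Q P \<Phi> by unfold_locales (rule assms)
  interpret G: inclusion U R P \<Psi> by unfold_locales (rule assms)
  show ?R if ?L
    unfolding trans_le_def closure_of_inclusion_def trans_comp_def
  proof (intro ballI)
    obtain \<Theta> where \<Theta>: "geometric_morphism U Q R \<Theta>"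
      and iso: "trans_iso U Q P (snd \<Phi>) (trans_comp (snd \<Psi>) (snd \<Theta>))"
      using \<open>?L\<close> by blast
    fix X x assume X: "X \<in> U" and x: "x \<in> carrier (fibre P X)"
    let ?y = "F.inverse X x"
    have y: "?y \<in> carrier (fibre Q X)" using X x by (rule F.inverse_closed)
    have "monotone_map (fibre Q X) (fibre R X) (snd \<Theta> X)"
      using \<Theta> X by (simp add: geometric_morphism_def is_transformation_def)
    then have z: "snd \<Theta> X ?y \<in> carrier (fibre R X)" using y by (rule monotone_mapD(1))
    have le: "F.direct X ?y \<sqsubseteq>\<^bsub>fibre P X\<^esub> G.direct X (snd \<Theta> X ?y)"
      and ge: "G.direct X (snd \<Theta> X ?y) \<sqsubseteq>\<^bsub>fibre P X\<^esub> F.direct X ?y"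
      using iso X y by (auto simp: trans_iso_def trans_le_def trans_comp_def)
    have "x \<sqsubseteq>\<^bsub>fibre P X\<^esub> G.direct X (snd \<Theta> X ?y)"
      by (rule F.P_trans[OF X F.unit[OF X x] le])
        (use X x y z F.direct_closed G.direct_closed in auto)
    then have "G.inverse X x \<sqsubseteq>\<^bsub>fibre R X\<^esub> snd \<Theta> X ?y"
      using X x z by (simp add: G.galois)
    then have "G.direct X (G.inverse X x) \<sqsubseteq>\<^bsub>fibre P X\<^esub> G.direct X (snd \<Theta> X ?y)"
      using X x z by (intro G.direct_mono) (auto intro: G.inverse_closed)
    from F.P_trans[OF X this ge]
    show "G.direct X (G.inverse X x) \<sqsubseteq>\<^bsub>fibre P X\<^esub> F.direct X ?y"
      using X x y z F.direct_closed G.direct_closed G.inverse_closed by auto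
  qed
  show ?L if ?R
  proof (intro exI conjI)
    let ?\<Theta> = "(trans_comp F.inverse G.direct, trans_comp G.inverse F.direct)"
    note closed = F.direct_closed G.direct_closed F.inverse_closed G.inverse_closed
    have closure_le: "G.direct X (G.inverse X x) \<sqsubseteq>\<^bsub>fibre P X\<^esub> F.direct X (F.inverse X x)"
      if "X \<in> U" "x \<in> carrier (fibre P X)" for X x
      using that \<open>?R\<close> by (simp add: trans_le_def closure_of_inclusion_def trans_comp_def)
    \<comment> \<open>the image of \<open>\<Phi>\<^sub>+\<close> is closed under \<open>\<Psi>\<close>\<close>
    have GF_le: "G.direct X (G.inverse X (F.direct X y)) \<sqsubseteq>\<^bsub>fibre P X\<^esub> F.direct X y"
      if "X \<in> U" "y \<in> carrier (fibre Q X)" for X y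
      using that
      by (intro F.P_trans[OF _ closure_le F.direct_mono[OF _ _ _ F.counit]]) (auto intro: closed)
    have "F.inverse X (G.direct X z) \<sqsubseteq>\<^bsub>fibre Q X\<^esub> y \<longleftrightarrow> z \<sqsubseteq>\<^bsub>fibre R X\<^esub> G.inverse X (F.direct X y)"
      if X: "X \<in> U" and z: "z \<in> carrier (fibre R X)" and y: "y \<in> carrier (fibre Q X)" for X y z
    proof -
      have "z \<sqsubseteq>\<^bsub>fibre R X\<^esub> G.inverse X (F.direct X y)" if "G.direct X z \<sqsubseteq>\<^bsub>fibre P X\<^esub> F.direct X y"
        by (rule G.Q_trans[OF X G.counit_inverse[OF X z] G.inverse_mono[OF X _ _ that]])
          (use X y z closed in auto)
      moreover have "G.direct X z \<sqsubseteq>\<^bsub>fibre P X\<^esub> F.direct X y" if "z \<sqsubseteq>\<^bsub>fibre R X\<^esub> G.inverse X (F.direct X y)"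
        by (rule F.P_trans[OF X G.direct_mono[OF X _ _ that] GF_le[OF X y]]) (use X y z closed in auto)
      ultimately show ?thesis using X y z closed by (auto simp: F.galois)
    qed
    then have "adjoint_maps (fibre R X) (fibre Q X) (fst ?\<Theta> X) (snd ?\<Theta> X)" if "X \<in> U" for X
      using that closed
      by (intro adjoint_mapsI heyting_pseudofunctorD(1)[OF F.pseudofunctors(1)]
          heyting_pseudofunctorD(1)[OF G.pseudofunctors(1)]) (auto simp: trans_comp_def)
    moreover have "cartesian_transformation U R Q (fst ?\<Theta>)" "cartesian_transformation U Q R (snd ?\<Theta>)"
      using cartesian_transformation_comp F.pseudofunctors G.pseudofunctors F.cartesian G.cartesian
      by (auto simp del: split_paired_All)
    ultimately show "geometric_morphism U Q R ?\<Theta>"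
      using F.triposes G.triposes by (simp add: geometric_morphism_def cartesian_transformation_def)
    show "trans_iso U Q P F.direct (trans_comp G.direct (snd ?\<Theta>))"
      using GF_le G.unit F.direct_closed by (auto simp: trans_iso_def trans_le_def trans_comp_def)
  qed
qed

section \<open>Nuclei as closure transformations\<close>

context arrow_logic
begin

lemma arrow_fibre_carrier:
  "carrier (fibre (arrow_tripos A) X) = range (\<lambda>\<phi>. restrict \<phi> X)"
  and arrow_fibre_le:
  "restrict \<phi> X \<sqsubseteq>\<^bsub>fibre (arrow_tripos A) X\<^esub> restrict \<psi> X \<longleftrightarrow> proves A X [\<phi>] \<psi>"
  and arrow_fibre_eq:
  "restrict \<phi> X .=\<^bsub>fibre (arrow_tripos A) X\<^esub> restrict \<psi> X \<longleftrightarrow> proves A X [\<phi>] \<psi> \<and> proves A X [\<psi>] \<phi>"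
  and arrow_reindex:
  "f \<in> X \<rightarrow> Y \<Longrightarrow> reindex (arrow_tripos A) X Y f (restrict \<phi> Y) = restrict (\<lambda>i. \<phi> (f i)) X"
  for X Y :: "'u set" and \<phi> \<psi> :: "'u \<Rightarrow> 'a"
proof -
  interpret coded_nucleus_logic A id "id :: ('u \<Rightarrow> 'a) \<Rightarrow> 'u \<Rightarrow> 'a"
    by unfold_locales (simp_all add: nucleus_id)
  have el: "element id X \<phi> = restrict \<phi> X" for X and \<phi> :: "'u \<Rightarrow> 'a" by (simp add: element_def)
  note le = fibre_le[unfolded el]
  show "carrier (fibre (arrow_tripos A) X) = range (\<lambda>\<phi>. restrict \<phi> X)"
    by (simp add: arrow_tripos_eq_closed_tripos fibre_carrier element_def[abs_def])
  show "restrict \<phi> X \<sqsubseteq>\<^bsub>fibre (arrow_tripos A) X\<^esub> restrict \<psi> X \<longleftrightarrow> proves A X [\<phi>] \<psi>"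
    unfolding arrow_tripos_eq_closed_tripos le by simp
  show "restrict \<phi> X .=\<^bsub>fibre (arrow_tripos A) X\<^esub> restrict \<psi> X \<longleftrightarrow> proves A X [\<phi>] \<psi> \<and> proves A X [\<psi>] \<phi>"
    unfolding arrow_tripos_eq_closed_tripos fibre_eq le by simp
  show "reindex (arrow_tripos A) X Y f (restrict \<phi> Y) = restrict (\<lambda>i. \<phi> (f i)) X" if "f \<in> X \<rightarrow> Y"
    unfolding arrow_tripos_eq_closed_tripos reindex_element[OF that, unfolded el] ..
qed

lemma proves_trans: "proves A I G p \<Longrightarrow> proves A I [p] q \<Longrightarrow> proves A I G q"
  by (erule proves_cut) (auto elim: proves_weaken)

lemma proves_at: "proves A UNIV [p] q \<Longrightarrow> proves A I G (\<lambda>i. p (f i)) \<Longrightarrow> proves A I G (\<lambda>i. q (f i))"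
  by (erule proves_trans) (use proves_reindex[of UNIV "[p]" q I f] in auto)

lemma weak_partial_order_nuclei: "weak_partial_order (nuclei A)"
  unfolding nuclei_def
  by (rule weak_partial_order_preorder_of)
    (auto simp: entails_iff_proves proves_hyp elim: proves_trans)

end

lemma induced_transformation_restrict:
  "induced_transformation j X (restrict \<phi> X) = restrict (\<lambda>i. j (\<phi> i)) X"
  by (auto simp: induced_transformation_def compose_def restrict_def)

context nucleus_logic
begin

lemma nucleus_entails: "proves A I [p] q \<Longrightarrow> proves A I [\<lambda>i. j (p i)] (\<lambda>i. j (q i))"
  by (rule proves_bind[OF proves_hyp], simp, rule proves_unit) (auto elim: proves_weaken)

lemma nucleus_idem: "proves A I [\<lambda>i. j (j (p i))] (\<lambda>i. j (p i))"
  by (rule proves_bind[OF proves_hyp]) (auto intro: proves_hyp)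

text \<open>
  The second clause internalizes functoriality: it is the map \<open>j (a \<leadsto> a') \<leadsto> j a \<leadsto> j a'\<close> of an
  applicative functor, obtained by binding both arguments. The third one says that \<open>j\<close> respects
  entailment between families indexed by \<open>X\<close>.
\<close>

lemma implicative_morphism: "implicative_morphism A A j"
  unfolding implicative_morphism_def
proof (intro conjI ballI allI impI)
  fix a assume a: "a \<in> separator A"
  have "(INF a. a \<leadsto> j a) \<in> separator A" using nucleus by (simp add: nucleus_def)
  then have "(a \<leadsto> j a) \<in> separator A" by (rule separator_up) (rule INF_lower[OF UNIV_I])
  then show "j a \<in> separator A" using a by (rule separator_mp)
next
  let ?h = "\<lambda>x. fst x \<leadsto> snd x"
  have "proves A (UNIV :: ('a \<times> 'a) set) [\<lambda>x. j (fst x), \<lambda>x. j (?h x)] (\<lambda>x. j (snd x))"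
  proof (rule proves_bind)
    show "proves A (UNIV :: ('a \<times> 'a) set) [\<lambda>x. j (fst x), \<lambda>x. j (?h x)] (\<lambda>x. j (?h x))"
      by (simp add: proves_hyp)
    show "proves A (UNIV :: ('a \<times> 'a) set) [?h, \<lambda>x. j (fst x), \<lambda>x. j (?h x)] (\<lambda>x. j (snd x))"
      by (rule proves_bind[where p = fst], simp add: proves_hyp, rule proves_unit,
          rule proves_mp[where p = fst]) (simp_all add: proves_hyp)
  qed
  then have "valid A UNIV (\<lambda>x. j (?h x) \<leadsto> j (fst x) \<leadsto> j (snd x))"
    by (simp add: valid_iff_proves proves_Cons)
  then show "\<exists>r\<in>separator A. \<forall>a a'. r \<le> (j (a \<leadsto> a') \<leadsto> j a \<leadsto> j a')"
    unfolding valid_def by (rule bexI[rotated]) (auto intro!: INF_lower2[where i = "(a, b)" for a b])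
next
  fix X :: "('a \<times> 'a) set" assume "(INF (a, a')\<in>X. a \<leadsto> a') \<in> separator A"
  then have "proves A X [fst] snd"
    by (simp add: valid_def case_prod_unfold flip: valid_iff_proves)
  then have "proves A X [\<lambda>x. j (fst x)] (\<lambda>x. j (snd x))" by (rule nucleus_entails)
  then show "(INF (a, a')\<in>X. j a \<leadsto> j a') \<in> separator A"
    by (simp add: valid_def case_prod_unfold flip: valid_iff_proves)
qed

text \<open>
  A greatest lower bound in a fibre is known only by its universal property, so preservation is
  checked by comparing it with a conjunction \<open>c\<close> built from the finitely many members, through which
  \<open>j\<close> can be pushed.
\<close>

lemma closed_finite_meet:
  assumes "finite F" and "\<And>\<phi>. \<phi> \<in> F \<Longrightarrow> proves A X [\<chi>] (\<lambda>i. j (\<phi> i))"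
  shows "\<exists>c. (\<forall>\<phi>\<in>F. proves A X [c] \<phi>) \<and> proves A X [\<chi>] (\<lambda>i. j (c i))"
  using assms
proof (induction F)
  case empty
  then show ?case by (auto intro: proves_unit proves_true)
next
  case (insert \<phi> F)
  then obtain c where c: "\<forall>\<psi>\<in>F. proves A X [c] \<psi>" "proves A X [\<chi>] (\<lambda>i. j (c i))" by auto
  let ?c = "\<lambda>i. \<phi> i \<^bold>\<and> c i"
  have "proves A X [?c] \<phi>" "proves A X [?c] c"
    by (rule proves_conjE[OF proves_hyp], auto intro: proves_hyp)+
  with c have "\<forall>\<psi>\<in>insert \<phi> F. proves A X [?c] \<psi>" by (auto intro: proves_trans)
  moreover have "proves A X [\<chi>] (\<lambda>i. j (?c i))"
    using insert.prems c by (simp add: closed_meet_iff)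
  ultimately show ?case by blast
qed

lemma closed_glb:
  fixes X :: "'u set"
  assumes F: "finite F" "F \<subseteq> carrier (fibre (arrow_tripos A) X)"
    and m: "greatest (fibre (arrow_tripos A) X) m (Lower (fibre (arrow_tripos A) X) F)"
    and \<chi>: "\<And>\<phi>. \<phi> \<in> F \<Longrightarrow> proves A X [\<chi>] (\<lambda>i. j (\<phi> i))"
  shows "proves A X [\<chi>] (\<lambda>i. j (m i))"
proof -
  obtain c where c: "\<forall>\<phi>\<in>F. proves A X [c] \<phi>" "proves A X [\<chi>] (\<lambda>i. j (c i))"
    using closed_finite_meet[OF F(1) \<chi>] by blast
  have restr: "restrict \<phi> X = \<phi>" if "\<phi> \<in> carrier (fibre (arrow_tripos A) X)" for \<phi>
    using that by (auto simp: arrow_fibre_carrier)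
  have "restrict c X \<sqsubseteq>\<^bsub>fibre (arrow_tripos A) X\<^esub> \<phi>" if "\<phi> \<in> F" for \<phi>
    using c(1) that restr[of \<phi>] F(2) arrow_fibre_le[of X c \<phi>] by auto
  then have "restrict c X \<sqsubseteq>\<^bsub>fibre (arrow_tripos A) X\<^esub> m"
    using m unfolding greatest_Lower_iff[OF F(2)] by (auto simp: arrow_fibre_carrier)
  then have "proves A X [c] m"
    using restr[of m] m arrow_fibre_le[of X c m] by auto
  from proves_trans[OF c(2) nucleus_entails[OF this]] show ?thesis .
qed

lemma closure_transformation_induced:
  fixes U :: "'u set set"
  shows "closure_transformation U (arrow_tripos A) (induced_transformation j)"
proof -
  let ?P = "arrow_tripos A :: ('u, 'u \<Rightarrow> 'a) indexed_preorder"
  let ?\<Phi> = "induced_transformation j :: ('u, 'u \<Rightarrow> 'a, 'u \<Rightarrow> 'a) transformation"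
  have wpo: "weak_partial_order (fibre ?P X)" for X
  proof -
    interpret coded_nucleus_logic A id "id :: ('u \<Rightarrow> 'a) \<Rightarrow> 'u \<Rightarrow> 'a"
      by unfold_locales (simp_all add: nucleus_id)
    show ?thesis by (simp add: arrow_tripos_eq_closed_tripos weak_partial_order_fibre)
  qed
  have mono: "monotone_map (fibre ?P X) (fibre ?P X) (?\<Phi> X)" for X
    unfolding monotone_map_def isotone_def
    by (auto simp: wpo arrow_fibre_carrier induced_transformation_restrict arrow_fibre_le nucleus_entails)
  have "?\<Phi> X (reindex ?P X Y f \<phi>) .=\<^bsub>fibre ?P X\<^esub> reindex ?P X Y f (?\<Phi> Y \<phi>)"
    if "f \<in> X \<rightarrow>\<^sub>E Y" "\<phi> \<in> carrier (fibre ?P Y)" for X Y f \<phi>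
    using that by (auto simp: arrow_fibre_carrier arrow_reindex PiE_def
        induced_transformation_restrict arrow_fibre_eq proves_hyp)
  then have "is_transformation U ?P ?P ?\<Phi>"
    using mono unfolding is_transformation_def by blast
  moreover have "preserves_finite_meets (fibre ?P X) (fibre ?P X) (?\<Phi> X)" for X
    unfolding preserves_finite_meets_def
  proof (intro allI impI, elim conjE)
    fix F m assume F: "finite F" "F \<subseteq> carrier (fibre ?P X)"
      and m: "greatest (fibre ?P X) m (Lower (fibre ?P X) F)"
    note m' = m[unfolded greatest_Lower_iff[OF F(2)]]
    have \<Phi>F: "?\<Phi> X ` F \<subseteq> carrier (fibre ?P X)" using F monotone_mapD(1)[OF mono] by auto
    have \<Phi>_eq: "?\<Phi> X \<phi> = restrict (\<lambda>i. j (\<phi> i)) X" if "\<phi> \<in> carrier (fibre ?P X)" for \<phi>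
      using that by (auto simp: arrow_fibre_carrier induced_transformation_restrict)
    show "greatest (fibre ?P X) (?\<Phi> X m) (Lower (fibre ?P X) (?\<Phi> X ` F))"
      unfolding greatest_Lower_iff[OF \<Phi>F]
    proof (intro conjI ballI impI)
      fix z assume z: "z \<in> carrier (fibre ?P X)" "\<forall>x\<in>?\<Phi> X ` F. z \<sqsubseteq>\<^bsub>fibre ?P X\<^esub> x"
      then obtain \<chi> where \<chi>: "z = restrict \<chi> X" by (auto simp: arrow_fibre_carrier)
      have "proves A X [\<chi>] (\<lambda>i. j (m i))"
      proof (rule closed_glb[OF F m])
        fix \<phi> assume \<phi>: "\<phi> \<in> F"
        then have "restrict \<chi> X \<sqsubseteq>\<^bsub>fibre ?P X\<^esub> restrict (\<lambda>i. j (\<phi> i)) X"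
          using z(2) by (auto simp: \<chi> simp flip: \<Phi>_eq[OF subsetD[OF F(2) \<phi>]])
        then show "proves A X [\<chi>] (\<lambda>i. j (\<phi> i))" by (simp only: arrow_fibre_le)
      qed
      then show "z \<sqsubseteq>\<^bsub>fibre ?P X\<^esub> ?\<Phi> X m"
        using m' \<Phi>_eq[of m] by (simp add: \<chi> arrow_fibre_le)
    qed (use F m' monotone_mapD[OF mono] in auto)
  qed
  moreover have "trans_le U ?P ?P trans_id ?\<Phi>"
    by (auto simp: trans_le_def trans_id_def arrow_fibre_carrier induced_transformation_restrict
        arrow_fibre_le closed_refl)
  moreover have "trans_iso U ?P ?P (trans_comp ?\<Phi> ?\<Phi>) ?\<Phi>"
    by (auto simp: trans_iso_def trans_le_def trans_comp_def arrow_fibre_carrier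
        induced_transformation_restrict arrow_fibre_le closed_refl nucleus_idem)
  ultimately show ?thesis
    by (simp add: closure_transformation_def cartesian_transformation_def)
qed

end

context arrow_logic
begin

text \<open>
  The identity of the algebra, transported to the set \<open>range code\<close>, is a generic element; comparing two
  transformations there compares \<open>f\<close> and \<open>g\<close> themselves.
\<close>

lemma entails_iff_induced_le:
  fixes code :: "'a \<Rightarrow> 'u"
  assumes code: "inj code" "range code \<in> U"
  shows "entails A UNIV f g \<longleftrightarrow>
    trans_le U (arrow_tripos A) (arrow_tripos A) (induced_transformation f) (induced_transformation g)"
proof
  assume "entails A UNIV f g"
  then have "proves A UNIV [f] g" by (simp add: entails_iff_proves)
  then have "proves A X [\<lambda>i. f (\<phi> i)] (\<lambda>i. g (\<phi> i))" for X and \<phi> :: "'u \<Rightarrow> 'a"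
    by (rule proves_at) (simp add: proves_hyp)
  then show "trans_le U (arrow_tripos A) (arrow_tripos A) (induced_transformation f) (induced_transformation g)"
    by (auto simp: trans_le_def arrow_fibre_carrier induced_transformation_restrict arrow_fibre_le)
next
  assume "trans_le U (arrow_tripos A) (arrow_tripos A) (induced_transformation f) (induced_transformation g)"
  then have "induced_transformation f (range code) (restrict (inv code) (range code))
      \<sqsubseteq>\<^bsub>fibre (arrow_tripos A) (range code)\<^esub>
      induced_transformation g (range code) (restrict (inv code) (range code))"
    using code(2) by (simp add: trans_le_def arrow_fibre_carrier)
  then have "proves A (range code) [\<lambda>u. f (inv code u)] (\<lambda>u. g (inv code u))"
    by (simp only: induced_transformation_restrict arrow_fibre_le)
  from proves_reindex[OF this, of UNIV code] show "entails A UNIV f g"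
    by (simp add: entails_iff_proves code(1))
qed

text \<open>
  A map which is a nucleus up to entailment is isomorphic to one that is monotone for
  the order of the algebra. It is replaced by \<open>j a = (INF a'\<in>{a..}. true \<leadsto> f a')\<close>: this is monotone because
  the index set of the meet shrinks as \<open>a\<close> grows, and it is equivalent to \<open>f a\<close> because \<open>f\<close> respects the
  entailment \<open>a \<leadsto> a'\<close> uniformly in all pairs \<open>a \<le> a'\<close>. The bind law is then derived in the
  usual way for a strong idempotent monad: pair \<open>f a\<close> with the unit at \<open>a \<leadsto> j b\<close>, apply
  preservation of meets and functoriality, and collapse \<open>f (f b)\<close>.
\<close>

lemma nucleus_of_lex_map:
  fixes f :: "'a \<Rightarrow> 'a"
  assumes rel: "\<And>R. proves A R [fst] snd \<Longrightarrow> proves A R [\<lambda>x. f (fst x)] (\<lambda>x. f (snd x))"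
    and meet: "proves A UNIV [\<lambda>x. f (fst x) \<^bold>\<and> f (snd x)] (\<lambda>x. f (fst x \<^bold>\<and> snd x))"
    and unit: "proves A UNIV [\<lambda>a. a] f"
    and idem: "proves A UNIV [\<lambda>a. f (f a)] f"
  shows "\<exists>j. nucleus A j \<and> entails A UNIV j f \<and> entails A UNIV f j"
proof (intro exI conjI)
  \<comment> \<open>the guard in \<open>forall\<close> makes this a meet of implications\<close>
  let ?j = "\<lambda>a. forall {a..} f"
  have j_f: "proves A UNIV [?j] f"
    by (rule proves_forallD[where f = "\<lambda>a. a", OF proves_hyp]) auto
  have f_j: "proves A UNIV [f] ?j"
  proof (rule proves_forallI)
    have "proves A (Sigma UNIV atLeast) [fst] snd"
      by (rule proves_mono[OF proves_hyp[of fst]]) auto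
    from rel[OF this] show "proves A (Sigma UNIV atLeast) (map (\<lambda>g x. g (fst x)) [f]) (\<lambda>x. f (snd x))"
      by simp
  qed
  show "entails A UNIV ?j f" "entails A UNIV f ?j"
    using j_f f_j by (simp_all add: entails_iff_proves)
  have "?j a \<le> ?j b" if "a \<le> b" for a b
    unfolding forall_def using that by (intro INF_superset_mono) auto
  moreover have "valid A UNIV (\<lambda>a. a \<leadsto> ?j a)"
    unfolding valid_iff_proves by (rule proves_trans[OF unit f_j])
  moreover have "valid A UNIV (\<lambda>x. (fst x \<leadsto> ?j (snd x)) \<leadsto> ?j (fst x) \<leadsto> ?j (snd x))"
  proof -
    let ?h = "\<lambda>x. fst x \<leadsto> ?j (snd x)" and ?m = "\<lambda>x. fst x \<^bold>\<and> (fst x \<leadsto> ?j (snd x))"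
    let ?G = "[\<lambda>x. ?j (fst x), ?h]" and ?I = "UNIV :: ('a \<times> 'a) set"
    have "proves A ?I ?G (\<lambda>x. f (fst x))" "proves A ?I ?G (\<lambda>x. f (?h x))"
      by (rule proves_at[OF j_f], simp add: proves_hyp) (rule proves_at[OF unit], simp add: proves_hyp)
    from proves_at[OF meet, of _ _ "\<lambda>x. (fst x, ?h x)"] proves_conjI[OF this]
    have 1: "proves A ?I ?G (\<lambda>x. f (?m x))" by simp
    have "proves A ?I [?m] (\<lambda>x. ?j (snd x))"
      by (rule proves_conjE[OF proves_hyp[of ?m]], simp, rule proves_mp[of _ _ fst])
        (simp_all add: proves_hyp)
    then have m: "proves A ?I [?m] (\<lambda>x. f (snd x))" by (rule proves_at[OF j_f])
    have "proves A ((\<lambda>x. (?m x, f (snd x))) ` ?I) [fst] snd"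
    proof -
      have "valid A ?I (\<lambda>x. ?m x \<leadsto> f (snd x))" using m by (simp only: valid_iff_proves)
      then show ?thesis unfolding valid_iff_proves[symmetric] by (simp add: valid_def image_image)
    qed
    from proves_reindex[OF rel[OF this], of ?I "\<lambda>x. (?m x, f (snd x))"]
    have "proves A ?I [\<lambda>x. f (?m x)] (\<lambda>x. f (f (snd x)))" by simp
    from proves_at[OF f_j proves_at[OF idem proves_trans[OF 1 this]]]
    show ?thesis unfolding valid_iff_proves by (simp only: proves_Cons)
  qed
  then have "(INF a. INF b. (a \<leadsto> ?j b) \<leadsto> ?j a \<leadsto> ?j b) \<in> separator A"
    unfolding valid_def
    by (rule separator_up) (auto intro!: INF_greatest INF_lower2[where i = "(a, b)" for a b])
  ultimately show "nucleus A ?j"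
    by (simp add: nucleus_def valid_def)
qed

text \<open>
  By naturality \<open>\<Phi>\<close> is determined by its value \<open>f\<close> at the generic element: it is postcomposition
  with \<open>f\<close> up to isomorphism. To see that \<open>f\<close> respects entailment and conjunction uniformly, one
  evaluates \<open>\<Phi>\<close> at the two projections from a set of pairs; closure of \<open>U\<close> under binary products
  and subsets provides these index sets.
\<close>

lemma nucleus_of_closure_transformation:
  fixes U :: "'u set set" and code :: "'a \<Rightarrow> 'u"
  assumes U: "set_universe U" and code: "inj code" "range code \<in> U"
    and cl: "closure_transformation U (arrow_tripos A) \<Phi>"
  shows "\<exists>j. nucleus A j \<and> trans_iso U (arrow_tripos A) (arrow_tripos A) (induced_transformation j) \<Phi>"
proof -
  let ?P = "arrow_tripos A :: ('u, 'u \<Rightarrow> 'a) indexed_preorder"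
  define S where "S = range code"
  define f where "f a = \<Phi> S (restrict (inv code) S) (code a)" for a
  have trans: "is_transformation U ?P ?P \<Phi>" and
    meets: "\<And>X. X \<in> U \<Longrightarrow> preserves_finite_meets (fibre ?P X) (fibre ?P X) (\<Phi> X)"
    using cl by (simp_all add: closure_transformation_def cartesian_transformation_def)
  then have mono: "\<And>X. X \<in> U \<Longrightarrow> monotone_map (fibre ?P X) (fibre ?P X) (\<Phi> X)"
    by (simp add: is_transformation_def)
  have S: "S \<in> U" using code by (simp add: S_def)
  have ext: "restrict (\<Phi> X (restrict \<phi> X)) X = \<Phi> X (restrict \<phi> X)" if "X \<in> U" for X \<phi>
    using monotone_mapD(1)[OF mono[OF that], of "restrict \<phi> X"] by (auto simp: arrow_fibre_carrier)
  \<comment> \<open>naturality along \<open>code \<circ> \<phi>\<close>, which pulls the generic element back to \<open>\<phi>\<close>\<close>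
  have rep: "proves A X [\<Phi> X (restrict \<phi> X)] (\<lambda>i. f (\<phi> i))"
    "proves A X [\<lambda>i. f (\<phi> i)] (\<Phi> X (restrict \<phi> X))" if X: "X \<in> U" for X \<phi>
  proof -
    let ?g = "restrict (code \<circ> \<phi>) X"
    have g: "?g \<in> X \<rightarrow>\<^sub>E S" by (auto simp: S_def)
    then have g': "?g \<in> X \<rightarrow> S" by auto
    have "\<Phi> X (reindex ?P X S ?g (restrict (inv code) S)) .=\<^bsub>fibre ?P X\<^esub>
        reindex ?P X S ?g (\<Phi> S (restrict (inv code) S))"
      using trans X S g unfolding is_transformation_def by (auto simp: arrow_fibre_carrier)
    moreover have "reindex ?P X S ?g (restrict (inv code) S) = restrict \<phi> X"
      unfolding arrow_reindex[OF g'] using code(1) by (auto simp: restrict_def fun_eq_iff)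
    moreover have "reindex ?P X S ?g (\<Phi> S (restrict (inv code) S)) = restrict (\<lambda>i. f (\<phi> i)) X"
      by (subst (1) ext[OF S, symmetric], unfold arrow_reindex[OF g'])
        (auto simp: f_def restrict_def fun_eq_iff)
    ultimately have "restrict (\<Phi> X (restrict \<phi> X)) X .=\<^bsub>fibre ?P X\<^esub> restrict (\<lambda>i. f (\<phi> i)) X"
      by (simp add: ext[OF X])
    then show "proves A X [\<Phi> X (restrict \<phi> X)] (\<lambda>i. f (\<phi> i))"
      "proves A X [\<lambda>i. f (\<phi> i)] (\<Phi> X (restrict \<phi> X))"
      unfolding arrow_fibre_eq by auto
  qed
  have f_entails: "proves A X [\<lambda>i. f (\<phi> i)] (\<lambda>i. f (\<psi> i))" if X: "X \<in> U" and le: "proves A X [\<phi>] \<psi>" for X \<phi> \<psi>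
  proof -
    have "\<Phi> X (restrict \<phi> X) \<sqsubseteq>\<^bsub>fibre ?P X\<^esub> \<Phi> X (restrict \<psi> X)"
      using le by (intro monotone_mapD(2)[OF mono[OF X]]) (auto simp: arrow_fibre_carrier arrow_fibre_le)
    then have "restrict (\<Phi> X (restrict \<phi> X)) X \<sqsubseteq>\<^bsub>fibre ?P X\<^esub> restrict (\<Phi> X (restrict \<psi> X)) X"
      by (simp only: ext[OF X])
    then have "proves A X [\<Phi> X (restrict \<phi> X)] (\<Phi> X (restrict \<psi> X))"
      by (simp only: arrow_fibre_le)
    with rep[OF X] show ?thesis by (meson proves_trans)
  qed
  obtain Z h where Z: "Z \<in> U" and h: "bij_betw h (S \<times> S) Z"
    using U S unfolding set_universe_def by blast
  \<comment> \<open>the pairs of elements of the algebra, coded as elements of \<open>Z\<close>\<close>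
  define q where "q x = h (code (fst x), code (snd x))" for x
  have q: "inj q"
  proof (rule injI)
    fix x y assume "q x = q y"
    then have "(code (fst x), code (snd x)) = (code (fst y), code (snd y))"
      unfolding q_def by (rule inj_onD[OF bij_betw_imp_inj_on[OF h]]) (simp_all add: S_def)
    then show "x = y" using injD[OF code(1)] by (simp add: prod_eq_iff)
  qed
  have "range q \<subseteq> Z"
    using bij_betw_imp_surj_on[OF h] by (auto simp: q_def S_def)
  then have qU: "q ` R \<in> U" for R
    using U Z unfolding set_universe_def by (meson image_mono subset_UNIV subset_trans)
  have rel: "proves A R [\<lambda>x. f (fst x)] (\<lambda>x. f (snd x))" if "proves A R [fst] snd" for R
  proof -
    have "inv q u \<in> R" if "u \<in> q ` R" for u using that q by auto
    from proves_reindex[OF that this]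
    have "proves A (q ` R) [\<lambda>u. fst (inv q u)] (\<lambda>u. snd (inv q u))" by simp
    from proves_reindex[OF f_entails[OF qU this], of R q] q show ?thesis by simp
  qed
  have meet: "proves A UNIV [\<lambda>x. f (fst x) \<^bold>\<and> f (snd x)] (\<lambda>x. f (fst x \<^bold>\<and> snd x))"
  proof -
    let ?X = "range q" and ?p = "\<lambda>u. fst (inv q u)" and ?q = "\<lambda>u. snd (inv q u)"
    let ?m = "\<lambda>u. ?p u \<^bold>\<and> ?q u" and ?fm = "\<lambda>u. f (?p u) \<^bold>\<and> f (?q u)"
    let ?F = "{restrict ?p ?X, restrict ?q ?X}"
    have conj: "proves A ?X [\<lambda>u. a u \<^bold>\<and> b u] a" "proves A ?X [\<lambda>u. a u \<^bold>\<and> b u] b" for a b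
      by (rule proves_conjE[OF proves_hyp], auto intro: proves_hyp)+
    have F: "?F \<subseteq> carrier (fibre ?P ?X)" by (auto simp: arrow_fibre_carrier)
    \<comment> \<open>the conjunction of the two projections is their meet, and \<open>\<Phi>\<close> preserves it\<close>
    have m: "greatest (fibre ?P ?X) (restrict ?m ?X) (Lower (fibre ?P ?X) ?F)"
      unfolding greatest_Lower_iff[OF F]
      by (auto simp: arrow_fibre_carrier arrow_fibre_le conj intro: proves_conjI)
    have g: "greatest (fibre ?P ?X) (\<Phi> ?X (restrict ?m ?X)) (Lower (fibre ?P ?X) (\<Phi> ?X ` ?F))"
      by (rule meets[OF qU, unfolded preserves_finite_meets_def, rule_format]) (intro conjI F m, simp)
    have \<Phi>F: "\<Phi> ?X ` ?F \<subseteq> carrier (fibre ?P ?X)"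
      using F monotone_mapD(1)[OF mono[OF qU]] by auto
    have "restrict ?fm ?X \<sqsubseteq>\<^bsub>fibre ?P ?X\<^esub> \<Phi> ?X (restrict p ?X)" if "proves A ?X [?fm] (\<lambda>u. f (p u))" for p
      by (subst ext[OF qU, symmetric], unfold arrow_fibre_le) (rule proves_trans[OF that rep(2)[OF qU]])
    then have "restrict ?fm ?X \<sqsubseteq>\<^bsub>fibre ?P ?X\<^esub> \<Phi> ?X (restrict ?m ?X)"
      using g conj unfolding greatest_Lower_iff[OF \<Phi>F] by (auto simp: arrow_fibre_carrier)
    then have "restrict ?fm ?X \<sqsubseteq>\<^bsub>fibre ?P ?X\<^esub> restrict (\<Phi> ?X (restrict ?m ?X)) ?X"
      by (simp only: ext[OF qU])
    then have "proves A ?X [?fm] (\<lambda>u. f (?m u))"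
      unfolding arrow_fibre_le by (rule proves_trans[OF _ rep(1)[OF qU]])
    from proves_reindex[OF this, of UNIV q] q show ?thesis by simp
  qed
  let ?s = "\<Phi> S (restrict (inv code) S)"
  have "restrict (inv code) S \<sqsubseteq>\<^bsub>fibre ?P S\<^esub> restrict ?s S"
    using cl S unfolding ext[OF S]
    by (simp add: closure_transformation_def trans_le_def trans_id_def arrow_fibre_carrier)
  then have "proves A S [inv code] ?s" by (simp only: arrow_fibre_le)
  from proves_reindex[OF this, of UNIV code] code(1)
  have unit: "proves A UNIV [\<lambda>a. a] f" by (simp add: S_def f_def[abs_def])
  have "\<Phi> S ?s \<sqsubseteq>\<^bsub>fibre ?P S\<^esub> ?s"
    using cl S by (simp add: closure_transformation_def trans_iso_def trans_le_def trans_comp_def arrow_fibre_carrier)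
  then have "restrict (\<Phi> S (restrict ?s S)) S \<sqsubseteq>\<^bsub>fibre ?P S\<^esub> restrict ?s S"
    by (subst ext[OF S, of ?s]) (simp only: ext[OF S])
  then have "proves A S [\<Phi> S (restrict ?s S)] ?s" by (simp only: arrow_fibre_le)
  from proves_reindex[OF proves_trans[OF rep(2)[OF S] this], of UNIV code]
  have idem: "proves A UNIV [\<lambda>a. f (f a)] f" by (simp add: S_def f_def[abs_def])
  from nucleus_of_lex_map[OF rel meet unit idem]
  obtain j where j: "nucleus A j" "proves A UNIV [j] f" "proves A UNIV [f] j"
    unfolding entails_iff_proves by blast
  have "proves A X [\<lambda>i. j (\<phi> i)] (\<Phi> X (restrict \<phi> X))" "proves A X [\<Phi> X (restrict \<phi> X)] (\<lambda>i. j (\<phi> i))"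
    if "X \<in> U" for X \<phi>
    by (rule proves_trans[OF _ rep(2)[OF that]], rule proves_at[OF j(2)], simp add: proves_hyp)
      (rule proves_at[OF j(3) rep(1)[OF that]])
  then have "restrict (\<lambda>i. j (\<phi> i)) X .=\<^bsub>fibre ?P X\<^esub> restrict (\<Phi> X (restrict \<phi> X)) X" if "X \<in> U" for X \<phi>
    unfolding arrow_fibre_eq using that by simp
  then have "restrict (\<lambda>i. j (\<phi> i)) X .=\<^bsub>fibre ?P X\<^esub> \<Phi> X (restrict \<phi> X)" if "X \<in> U" for X \<phi>
    using that by (simp add: ext)
  then have "trans_iso U ?P ?P (induced_transformation j) \<Phi>"
    by (auto simp: trans_iso_def trans_le_def arrow_fibre_carrier induced_transformation_restrict)
      (simp_all add: arrow_tripos_def)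
  with j(1) show ?thesis by blast
qed

end

section \<open>The subtripos of closed families\<close>

context coded_nucleus_logic
begin

text \<open>
  The inclusion of the \<open>j\<close>-closed families: the inverse image is the identity on families, the direct
  image applies \<open>j\<close>.
\<close>

definition sheafification :: "('u, 'p, 'u \<Rightarrow> 'a) geometric" where
  "sheafification = (element e, \<lambda>X x. restrict (\<lambda>i. j (inv e x i)) X)"

lemma element_restrict: "element e X (restrict \<phi> X) = element e X \<phi>"
  by (simp add: element_def)

lemma direct_element: "snd sheafification X (element e X \<phi>) = restrict (\<lambda>i. j (\<phi> i)) X"
  by (auto simp: sheafification_def inv_element)

lemma inverse_restrict: "fst sheafification X (restrict \<phi> X) = element e X \<phi>"
  by (simp add: sheafification_def element_restrict)

lemma closure_of_sheafification:
  "\<phi> \<in> carrier (fibre (arrow_tripos A) X) \<Longrightarrow>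
    closure_of_inclusion sheafification X \<phi> = induced_transformation j X \<phi>"
  by (auto simp: arrow_fibre_carrier closure_of_inclusion_def trans_comp_def inverse_restrict
      direct_element induced_transformation_restrict)

lemma geometric_inclusion_sheafification:
  fixes code :: "'a \<Rightarrow> 'u"
  assumes code: "inj code" "range code \<in> U"
  shows "geometric_inclusion U Q (arrow_tripos A) sheafification"
proof -
  let ?P = "arrow_tripos A :: ('u, 'u \<Rightarrow> 'a) indexed_preorder"
  have P: "tripos U ?P" by (rule tripos_arrow_tripos[OF code])
  have adj: "adjoint_maps (fibre ?P X) (fibre Q X) (fst sheafification X) (snd sheafification X)"
    if "X \<in> U" for X
    using P that
    by (intro adjoint_mapsI weak_partial_order_fibre heyting_pseudofunctorD(1)[of U])
      (auto simp: tripos_def arrow_fibre_carrier fibre_carrier inverse_restrict direct_element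
        fibre_le arrow_fibre_le)
  have inv: "is_transformation U ?P Q (fst sheafification)"
    unfolding is_transformation_def using adj
    by (auto simp: adjoint_maps_def arrow_fibre_carrier arrow_reindex PiE_def inverse_restrict
        reindex_element fibre_eq fibre_le closed_refl)
  have dir: "is_transformation U Q ?P (snd sheafification)"
    unfolding is_transformation_def using adj
    by (auto simp: adjoint_maps_def fibre_carrier arrow_reindex PiE_def direct_element
        reindex_element arrow_fibre_eq proves_hyp)
  have "preserves_finite_meets (fibre ?P X) (fibre Q X) (fst sheafification X)" if X: "X \<in> U" for X
    unfolding preserves_finite_meets_def
  proof (intro allI impI, elim conjE)
    fix F m assume F: "finite F" "F \<subseteq> carrier (fibre ?P X)"
      and m: "greatest (fibre ?P X) m (Lower (fibre ?P X) F)"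
    note m' = m[unfolded greatest_Lower_iff[OF F(2)]]
    have mono: "monotone_map (fibre ?P X) (fibre Q X) (fst sheafification X)"
      using adj[OF X] by (simp add: adjoint_maps_def)
    have IF: "fst sheafification X ` F \<subseteq> carrier (fibre Q X)"
      using F monotone_mapD(1)[OF mono] by auto
    show "greatest (fibre Q X) (fst sheafification X m) (Lower (fibre Q X) (fst sheafification X ` F))"
      unfolding greatest_Lower_iff[OF IF]
    proof (intro conjI ballI impI)
      fix z assume z: "z \<in> carrier (fibre Q X)" "\<forall>x\<in>fst sheafification X ` F. z \<sqsubseteq>\<^bsub>fibre Q X\<^esub> x"
      then obtain \<chi> where \<chi>: "z = element e X \<chi>" by (auto simp: fibre_carrier)
      have "proves A X [\<chi>] (\<lambda>i. j (m i))"
        by (rule closed_glb[OF F m]) (use z(2) in \<open>auto simp: \<chi> sheafification_def fibre_le\<close>)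
      then show "z \<sqsubseteq>\<^bsub>fibre Q X\<^esub> fst sheafification X m"
        by (simp add: \<chi> sheafification_def fibre_le)
    qed (use F m' monotone_mapD[OF mono] in auto)
  qed
  then have "geometric_morphism U Q ?P sheafification"
    using adj inv dir P tripos_closed_tripos[OF code]
    by (simp add: geometric_morphism_def cartesian_transformation_def)
  then show ?thesis
    by (auto simp: geometric_inclusion_def trans_iso_def trans_le_def trans_comp_def trans_id_def
        fibre_carrier direct_element inverse_restrict fibre_le closed_refl proves_unit proves_hyp)
qed

end

section \<open>The two equivalences\<close>

lemma (in arrow_logic) nuclei_equivalent_ClTrans:
  fixes U :: "'u set set" and code :: "'a \<Rightarrow> 'u"
  assumes "set_universe U" "inj code" "range code \<in> U"
  shows "preorder_equivalence (nuclei A) (ClTrans U (arrow_tripos A)) induced_transformation"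
  unfolding nuclei_def
proof (rule preorder_equivalence_of_embedding)
  show "weak_partial_order (ClTrans U (arrow_tripos A))"
    using tripos_arrow_tripos[OF assms(2,3)] by (auto simp: tripos_def intro: weak_partial_order_ClTrans)
  have "nucleus_logic A j" if "nucleus A j" for j
    using that by unfold_locales
  then show "induced_transformation \<in> {j. nucleus A j} \<rightarrow> carrier (ClTrans U (arrow_tripos A))"
    by (auto simp: ClTrans_def intro: nucleus_logic.closure_transformation_induced)
next
  fix f g
  show "entails A UNIV f g \<longleftrightarrow> induced_transformation f \<sqsubseteq>\<^bsub>ClTrans U (arrow_tripos A)\<^esub> induced_transformation g"
    unfolding entails_iff_induced_le[OF assms(2,3)] by (simp add: ClTrans_def)
next
  fix \<Phi> assume "\<Phi> \<in> carrier (ClTrans U (arrow_tripos A))"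
  then show "\<exists>j\<in>{j. nucleus A j}. induced_transformation j .=\<^bsub>ClTrans U (arrow_tripos A)\<^esub> \<Phi>"
    using nucleus_of_closure_transformation[OF assms] by (auto simp: ClTrans_def trans_iso_def)
qed

text \<open>
  An inclusion is sent to a nucleus representing its closure transformation. This reverses and
  reflects the order by \<open>subtripos_le_iff_closure_ge\<close>, and a nucleus \<open>j\<close> is reached from the
  inclusion of its \<open>j\<close>-closed families.
\<close>

lemma (in arrow_logic) SubTrip_equivalent_nuclei:
  fixes U :: "'u set set" and code :: "'a \<Rightarrow> 'u" and emb :: "('u \<Rightarrow> 'a) \<Rightarrow> 'q"
  assumes U: "set_universe U" and code: "inj code" "range code \<in> U" and emb: "inj emb"
  shows "preorders_equivalent
       (SubTrip U (arrow_tripos A) ::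
         (('u, 'q) indexed_preorder \<times> ('u, 'q, 'u \<Rightarrow> 'a) geometric) gorder)
       (inv_gorder (nuclei A))"
proof -
  let ?P = "arrow_tripos A :: ('u, 'u \<Rightarrow> 'a) indexed_preorder"
  let ?le = "trans_le U ?P ?P"
  let ?S = "{(Q, \<Phi>). geometric_inclusion U Q ?P \<Phi>} ::
    (('u, 'q) indexed_preorder \<times> ('u, 'q, 'u \<Rightarrow> 'a) geometric) set"
  define nuc where "nuc \<Phi> = (SOME j. nucleus A j \<and>
      trans_iso U ?P ?P (induced_transformation j) (closure_of_inclusion \<Phi>))"
    for \<Phi> :: "('u, 'q, 'u \<Rightarrow> 'a) geometric"
  have nuc: "nucleus A (nuc \<Phi>)"
    "trans_iso U ?P ?P (induced_transformation (nuc \<Phi>)) (closure_of_inclusion \<Phi>)"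
    if "geometric_inclusion U Q ?P \<Phi>" for Q :: "('u, 'q) indexed_preorder" and \<Phi>
  proof -
    interpret inclusion U Q ?P \<Phi> by unfold_locales (rule that)
    from someI_ex[OF nucleus_of_closure_transformation[OF U code closure_transformation]]
    show "nucleus A (nuc \<Phi>)"
      "trans_iso U ?P ?P (induced_transformation (nuc \<Phi>)) (closure_of_inclusion \<Phi>)"
      unfolding nuc_def by auto
  qed
  interpret C: weak_partial_order "ClTrans U ?P"
    using tripos_arrow_tripos[OF code] by (auto simp: tripos_def intro: weak_partial_order_ClTrans)
  have closure: "closure_transformation U ?P (closure_of_inclusion \<Phi>)"
    if "geometric_inclusion U Q ?P \<Phi>" for Q :: "('u, 'q) indexed_preorder" and \<Phi>
    using that by (intro inclusion.closure_transformation inclusion.intro)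
  have induced: "closure_transformation U ?P (induced_transformation j)" if "nucleus A j" for j
    using that by (intro nucleus_logic.closure_transformation_induced nucleus_logic.intro
        arrow_logic_axioms nucleus_logic_axioms.intro)
  have "preorder_equivalence (SubTrip U ?P) (inv_gorder (nuclei A)) (\<lambda>(Q, \<Phi>). nuc \<Phi>)"
    unfolding SubTrip_def
  proof (rule preorder_equivalence_of_embedding; (elim CollectE case_prodE)?)
    show "weak_partial_order (inv_gorder (nuclei A))"
      using weak_partial_order_nuclei by (simp only: dual_weak_order_iff)
    show "(\<lambda>(Q, \<Phi>). nuc \<Phi>) \<in> ?S \<rightarrow> carrier (inv_gorder (nuclei A))"
      using nuc(1) by (auto simp: nuclei_def)
  next
    fix x y and Q R :: "('u, 'q) indexed_preorder" and \<Phi> \<Psi>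
    assume xy: "x = (Q, \<Phi>)" "y = (R, \<Psi>)" and incl: "geometric_inclusion U Q ?P \<Phi>" "geometric_inclusion U R ?P \<Psi>"
    have "?le (closure_of_inclusion \<Psi>) (closure_of_inclusion \<Phi>) \<longleftrightarrow>
        ?le (induced_transformation (nuc \<Psi>)) (induced_transformation (nuc \<Phi>))"
      using C.le_cong[of "closure_of_inclusion \<Psi>" "induced_transformation (nuc \<Psi>)"
          "closure_of_inclusion \<Phi>" "induced_transformation (nuc \<Phi>)"]
        nuc[OF incl(1)] nuc[OF incl(2)] closure[OF incl(1)] closure[OF incl(2)] induced
      by (auto simp: ClTrans_def trans_iso_def)
    then show "(case x of (Q, \<Phi>) \<Rightarrow> \<lambda>(R, \<Psi>). \<exists>\<Theta>. geometric_morphism U Q R \<Theta> \<and>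
          trans_iso U Q ?P (snd \<Phi>) (trans_comp (snd \<Psi>) (snd \<Theta>))) y \<longleftrightarrow>
        (case x of (Q, \<Phi>) \<Rightarrow> nuc \<Phi>) \<sqsubseteq>\<^bsub>inv_gorder (nuclei A)\<^esub> (case y of (Q, \<Phi>) \<Rightarrow> nuc \<Phi>)"
      using subtripos_le_iff_closure_ge[OF incl]
      by (simp add: xy nuclei_def entails_iff_induced_le[OF code])
  next
    fix j assume "j \<in> carrier (inv_gorder (nuclei A))"
    then have j: "nucleus A j" by (simp add: nuclei_def)
    interpret coded_nucleus_logic A j emb by unfold_locales (rule j, rule emb)
    have incl: "geometric_inclusion U Q ?P sheafification"
      by (rule geometric_inclusion_sheafification[OF code])
    from nuc(2)[OF this]
    have "trans_iso U ?P ?P (induced_transformation (nuc sheafification)) (induced_transformation j)"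
      by (simp add: trans_iso_def trans_le_def closure_of_sheafification)
    then have "nuc sheafification .=\<^bsub>nuclei A\<^esub> j"
      by (simp add: trans_iso_def nuclei_def entails_iff_induced_le[OF code])
    with incl show "\<exists>x\<in>?S. (case x of (R, \<Psi>) \<Rightarrow> nuc \<Psi>) .=\<^bsub>inv_gorder (nuclei A)\<^esub> j"
      by (intro bexI[where x = "(Q, sheafification)"]) auto
  qed
  then show ?thesis unfolding preorders_equivalent_def by blast
qed

theorem proposition7p7:
  fixes U :: "'u set set"
    and A :: "'a::complete_lattice arrow_structure"
    and code :: "'a \<Rightarrow> 'u"
    and emb :: "('u \<Rightarrow> 'a) \<Rightarrow> 'q"
  assumes "set_universe U"
    and "inj code" and "range code \<in> U"
    and "inj emb"
    and "arrow_algebra A"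
  shows "(\<forall>j\<in>carrier (nuclei A). implicative_morphism A A j) \<and>
     preorder_equivalence (nuclei A) (ClTrans U (arrow_tripos A)) induced_transformation \<and>
     preorders_equivalent
       (SubTrip U (arrow_tripos A) ::
         (('u, 'q) indexed_preorder \<times> ('u, 'q, 'u \<Rightarrow> 'a) geometric) gorder)
       (inv_gorder (nuclei A))"
proof -
  interpret arrow_logic A by unfold_locales (rule assms)
  have "implicative_morphism A A j" if "nucleus A j" for j
    using that by (intro nucleus_logic.implicative_morphism nucleus_logic.intro
        arrow_logic_axioms nucleus_logic_axioms.intro)
  then show ?thesis
    using nuclei_equivalent_ClTrans[OF assms(1-3)] SubTrip_equivalent_nuclei[OF assms(1-4)]
    by (simp add: nuclei_def)
qed

end
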